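(* Let $n\ge2$, let $\Omega\subset\mathbb{R}^n$ be a bounded domain with $0\in\Omega$, and let $\Omega^*\supset\Omega$ be a domain for which there is a positive function $\lambda\in C^{0,1}(\Omega^* )$ with $|x|<\lambda(x)$ and $\langle x,\nabla\lambda(x)\rangle\le 0$ for a.e. $x\in\Omega^*$. Let $\alpha,\beta\in\mathbb{R}$, $p>1$, $\beta p>1$, $\alpha p\le n+\beta p-1$, and let $v,w$ be the weights defined in the context. Then for every $u\in W^{1,p}_{0,v}(\Omega)$ $$\int_\Omega v^p|\nabla u|^p\,dx\ \ge\ \gamma^p\int_\Omega w^p|u|^p\,dx,\qquad \gamma=\frac{\beta p-1}{p}.$$
   Context: Put $k=\frac{n-\alpha p}{\beta p-1}$, $s(x)=\frac{|x|}{\lambda(x)}$, and $$g(s)=\begin{cases}\dfrac{1-s^k}{k},&k\ne0,\\[4pt] \ln\dfrac1s,&k=0.\end{cases}$$ The weights are $v(x)=|x|^{1-\alpha}|g(s(x))|^{1-\beta}$ and $w(x)=|x|^{-\alpha}|g(s(x))|^{-\beta}$. The space $W^{1,p}_{0,v}(\Omega)$ is the completion of $C_0^\infty(\Omega)$ with respect to the norm $\left(\int_\Omega v^p|\nabla u|^p\,dx\right)^{1/p}$. *)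

theory Defs
  imports "HOL-Analysis.Analysis"
begin

primrec Ck :: "nat \<Rightarrow> ('a::euclidean_space \<Rightarrow> real) \<Rightarrow> bool" where
  "Ck 0 f \<longleftrightarrow> continuous_on UNIV f"
| "Ck (Suc k) f \<longleftrightarrow> (\<forall>x. f differentiable (at x)) \<and>
     (\<forall>h. Ck k (\<lambda>x. frechet_derivative f (at x) h))"

text \<open>Elements of \<open>C\<^sub>0\<^sup>\<infinity>(\<Omega>)\<close> are represented by their extensions by zero, which are smooth on the
  whole space.\<close>

definition test_functions :: "'a::euclidean_space set \<Rightarrow> ('a \<Rightarrow> real) set" where
  "test_functions \<Omega> = {\<phi>. (\<forall>k. Ck k \<phi>) \<and>
     compact (closure {x. \<phi> x \<noteq> 0}) \<and> closure {x. \<phi> x \<noteq> 0} \<subseteq> \<Omega>}"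

definition grad :: "('a::euclidean_space \<Rightarrow> real) \<Rightarrow> 'a \<Rightarrow> 'a" where
  "grad f x = (THE D. GDERIV f x :> D)"

text \<open>\<open>C\<^sup>0\<^sup>,\<^sup>1\<close> of an open set is read as local Lipschitz continuity; no uniform constant up to
  the boundary is required.\<close>

definition loc_lipschitz_on :: "'a::metric_space set \<Rightarrow> ('a \<Rightarrow> real) \<Rightarrow> bool" where
  "loc_lipschitz_on S f \<longleftrightarrow> (\<forall>x\<in>S. \<exists>e>0. \<exists>L. L-lipschitz_on (ball x e \<inter> S) f)"

definition weight_index :: "nat \<Rightarrow> real \<Rightarrow> real \<Rightarrow> real \<Rightarrow> real" where
  "weight_index n \<alpha> \<beta> p = (real n - \<alpha> * p) / (\<beta> * p - 1)"

definition g_fun :: "real \<Rightarrow> real \<Rightarrow> real" where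
  "g_fun k s = (if k = 0 then ln (1 / s) else (1 - s powr k) / k)"

text \<open>Since \<open>0 powr a = 0\<close> for every \<open>a\<close>, the values of the weights at the origin are
  conventional; the origin is a null set.\<close>

definition weight_v :: "real \<Rightarrow> real \<Rightarrow> real \<Rightarrow> (real^'n \<Rightarrow> real) \<Rightarrow> real^'n \<Rightarrow> real" where
  "weight_v \<alpha> \<beta> p lam x = norm x powr (1 - \<alpha>) *
     \<bar>g_fun (weight_index CARD('n) \<alpha> \<beta> p) (norm x / lam x)\<bar> powr (1 - \<beta>)"

definition weight_w :: "real \<Rightarrow> real \<Rightarrow> real \<Rightarrow> (real^'n \<Rightarrow> real) \<Rightarrow> real^'n \<Rightarrow> real" where
  "weight_w \<alpha> \<beta> p lam x = norm x powr (- \<alpha>) *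
     \<bar>g_fun (weight_index CARD('n) \<alpha> \<beta> p) (norm x / lam x)\<bar> powr (- \<beta>)"

text \<open>The \<open>p\<close>-th power of the norm of \<open>F\<close> in the weighted Lebesgue space, with values in \<open>[0,\<infinity>]\<close>.
  For \<open>F = grad \<phi>\<close> it is the \<open>p\<close>-th power of the norm on \<open>C\<^sub>0\<^sup>\<infinity>(\<Omega>)\<close>.\<close>

definition weighted_energy ::
  "real \<Rightarrow> ('a::euclidean_space \<Rightarrow> real) \<Rightarrow> 'a set \<Rightarrow> ('a \<Rightarrow> 'b::real_normed_vector) \<Rightarrow> ennreal" where
  "weighted_energy p \<rho> \<Omega> F =
     (\<integral>\<^sup>+x. ennreal (\<rho> x powr p * norm (F x) powr p) \<partial>lebesgue_on \<Omega>)"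

text \<open>The completion of \<open>C\<^sub>0\<^sup>\<infinity>(\<Omega>)\<close> is realised by functions. Weighted \<open>L\<^sup>p\<close> being complete,
  a sequence of test functions is Cauchy for the norm iff its gradients converge to some \<open>G\<close> in
  weighted \<open>L\<^sup>p\<close>; such a sequence represents the element \<open>u\<close> to which it converges almost everywhere,
  and the gradient of that element is \<open>G\<close>. (It is not defined as a distributional gradient on \<open>\<Omega>\<close>,
  because \<open>G\<close> need not be locally integrable at the origin.)\<close>

definition sobolev0_gradient ::
  "real \<Rightarrow> ('a::euclidean_space \<Rightarrow> real) \<Rightarrow> 'a set \<Rightarrow> ('a \<Rightarrow> real) \<Rightarrow> ('a \<Rightarrow> 'a) \<Rightarrow> bool" where
  "sobolev0_gradient p \<rho> \<Omega> u G \<longleftrightarrow> G \<in> borel_measurable (lebesgue_on \<Omega>) \<and>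
     (\<exists>\<phi>. (\<forall>m::nat. \<phi> m \<in> test_functions \<Omega>) \<and>
       ((\<lambda>m. weighted_energy p \<rho> \<Omega> (\<lambda>x. grad (\<phi> m) x - G x)) \<longlonglongrightarrow> 0) \<and>
       (AE x in lebesgue_on \<Omega>. (\<lambda>m. \<phi> m x) \<longlonglongrightarrow> u x))"

definition sobolev0 ::
  "real \<Rightarrow> ('a::euclidean_space \<Rightarrow> real) \<Rightarrow> 'a set \<Rightarrow> ('a \<Rightarrow> real) set" where
  "sobolev0 p \<rho> \<Omega> = {u. \<exists>G. sobolev0_gradient p \<rho> \<Omega> u G}"

end

theory Submission
  imports Defs
begin

text \<open>Formally, the field \<open>x |x| powr (-\<alpha>p) g(s) powr (1-\<beta>p)\<close> has divergence at least
  \<open>(\<beta>p-1) w powr p\<close>, because \<open>k g + s powr k = 1\<close> and \<open>\<lambda>\<close> does not increase along rays; testing it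
  against \<open>|\<phi>| powr p\<close> and applying Young's inequality pointwise gives the estimate. The divergence
  theorem is replaced by the dilation invariance of Lebesgue measure: with the singular set cut off,
  \<open>t ^ n * \<integral> H (t x) dx\<close> does not depend on \<open>t\<close>, and the monotonicity of \<open>\<lambda>\<close> bounds the integrand
  from below by a function that is smooth in \<open>t\<close> and agrees with it at \<open>t = 1\<close>.
  The cutoff \<open>|x| \<ge> \<epsilon>\<close> may be sharp since dilation by \<open>t \<ge> 1\<close> can only enlarge its indicator.
  The general case follows by Fatou's lemma.\<close>

section \<open>The profile function and powers\<close>

text \<open>The obstacle is that \<open>lam\<close> is only locally Lipschitz: its gradient is known
  off a null set, and a ray may lie inside that set. The sign condition on the gradient is therefore
  turned into monotonicity along every segment of a ray in the domain; after that \<open>lam\<close>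
  is never differentiated. Monotonicity suffices because s(t x) = t |x| / lam(t x) \<ge> t s(x) for
  t \<ge> 1. Writing t s(x) for s(t x) freezes \<open>lam\<close> at x and lowers the integrand,
  since g decreases and occurs with the negative exponent 1 - \<beta>p. The domain need not be
  star-shaped; t stays so close to 1 that the segments used remain near the support of the test
  function. In terms of the divergence theorem, the sharp cutoff adds only the flux through the
  sphere |x| = \<epsilon>, whose outer normal points to the origin while the field points away from
  it, so the sign is favourable.\<close>

lemma g_fun_pos:
  assumes "0 < s" "s < 1"
  shows "0 < g_fun k s"
proof (cases "k = 0")
  case True
  then show ?thesis using assms by (simp add: g_fun_def)
next
  case False
  show ?thesis
  proof (cases "k > 0")
    case True
    then have "s powr k < 1 powr k"
      using assms by (intro powr_less_mono2) auto
    with True show ?thesis by (simp add: g_fun_def)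
  next
    case k: False
    with False have "k < 0" by simp
    then have "1 powr k < s powr k"
      using assms by (intro powr_less_mono2_neg) auto
    with \<open>k < 0\<close> show ?thesis by (simp add: g_fun_def divide_neg_neg)
  qed
qed

text \<open>One formula serves both branches of \<open>g_fun\<close>, so the dilation argument needs
  no separate treatment of k = 0.\<close>

lemma DERIV_g_fun:
  assumes "0 < s"
  shows "(g_fun k has_real_derivative - (s powr (k - 1))) (at s)"
proof (cases "k = 0")
  case True
  have "((\<lambda>s. ln (1 / s)) has_real_derivative - (s powr (- 1))) (at s)"
    using assms by (auto intro!: derivative_eq_intros simp: powr_minus divide_simps)
  then show ?thesis using True by (simp add: g_fun_def[abs_def])
next
  case False
  have "((\<lambda>s. (1 - s powr k) / k) has_real_derivative - (s powr (k - 1))) (at s)"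
    using assms False by (auto intro!: derivative_eq_intros)
  then show ?thesis using False by (simp add: g_fun_def[abs_def])
qed

lemma g_fun_antimono:
  assumes "0 < s" "s \<le> t"
  shows "g_fun k t \<le> g_fun k s"
  using assms(2)
proof (rule DERIV_nonpos_imp_nonincreasing)
  fix x assume "s \<le> x" "x \<le> t"
  then show "\<exists>y. DERIV (g_fun k) x :> y \<and> y \<le> 0"
    using assms by (intro exI[of _ "- (x powr (k - 1))"] conjI DERIV_g_fun) auto
qed

lemma continuous_on_g_fun: "continuous_on {0<..} (g_fun k)"
  by (rule DERIV_continuous_on, rule has_field_derivative_at_within, rule DERIV_g_fun) simp

text \<open>Test functions change sign, so the derivative is also needed at 0. There the difference
  quotient is sgn h |h|^(p - 1), which tends to 0 because p > 1.\<close>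

lemma DERIV_abs_powr:
  fixes y p :: real
  assumes "1 < p"
  shows "((\<lambda>y. \<bar>y\<bar> powr p) has_real_derivative p * (sgn y * \<bar>y\<bar> powr (p - 1))) (at y)"
proof -
  consider "y > 0" | "y < 0" | "y = 0" by linarith
  then show ?thesis
  proof cases
    case 1
    have "((\<lambda>y. y powr p) has_real_derivative p * (sgn y * \<bar>y\<bar> powr (p - 1))) (at y)"
      using 1 by (auto intro!: derivative_eq_intros)
    moreover have "\<forall>\<^sub>F y in nhds y. y powr p = \<bar>y\<bar> powr p"
      using 1 by (auto intro: eventually_mono[OF eventually_nhds_in_open[of "{0<..}"]])
    ultimately show ?thesis
      by (subst (asm) DERIV_cong_ev[OF refl _ refl]) auto
  next
    case 2
    have "((\<lambda>y. (- y) powr p) has_real_derivative p * (sgn y * \<bar>y\<bar> powr (p - 1))) (at y)"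
      using 2 by (auto intro!: derivative_eq_intros)
    moreover have "\<forall>\<^sub>F y in nhds y. (- y) powr p = \<bar>y\<bar> powr p"
      using 2 by (auto intro: eventually_mono[OF eventually_nhds_in_open[of "{..<0}"]])
    ultimately show ?thesis
      by (subst (asm) DERIV_cong_ev[OF refl _ refl]) auto
  next
    case 3
    have "((\<lambda>h. \<bar>h\<bar> powr (p - 1)) \<longlongrightarrow> 0) (at (0::real))"
      using assms by (intro tendsto_zero_powrI[where b = "p - 1"] tendsto_rabs_zero tendsto_ident_at tendsto_const) auto
    then have "((\<lambda>h. sgn h * \<bar>h\<bar> powr (p - 1)) \<longlongrightarrow> 0) (at (0::real))"
      by (rule Lim_null_comparison[rotated]) (auto simp: abs_mult sgn_if)
    moreover have "\<bar>h\<bar> powr p / h = sgn h * \<bar>h\<bar> powr (p - 1)" if "h \<noteq> 0" for h :: real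
      using that by (auto simp: powr_diff sgn_if)
    ultimately show ?thesis
      using 3 assms by (simp add: DERIV_def cong: Lim_cong_within)
  qed
qed

lemma continuous_on_sgn_abs_powr:
  fixes a :: real
  assumes "0 < a"
  shows "continuous_on UNIV (\<lambda>y::real. sgn y * \<bar>y\<bar> powr a)"
proof -
  \<comment> \<open>The jump of \<open>sgn\<close> disappears on splitting into positive and
    negative parts: each is a continuous nonnegative function raised to a positive power, and
    \<open>0 powr a = 0\<close>.\<close>
  have "(\<lambda>y::real. sgn y * \<bar>y\<bar> powr a) = (\<lambda>y. max 0 y powr a - max 0 (- y) powr a)"
    by (auto simp: sgn_if max_def fun_eq_iff)
  moreover have "continuous_on UNIV (\<lambda>y::real. max 0 y powr a - max 0 (- y) powr a)"
    using assms by (intro continuous_intros continuous_on_powr') auto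
  ultimately show ?thesis by (simp only:)
qed

text \<open>Convexity of the power at the combination (1 - \<theta>) (a / (1 - \<theta>)) + \<theta>
  (b / \<theta>). The factor of a^p tends to 1 as \<theta> tends to 0, whereas b^p only has to be
  multiplied by something finite. This takes the place of the triangle inequality of weighted L^p
  when the gradients are passed to the limit.\<close>

lemma powr_add_le_weighted:
  fixes a b p \<theta> :: real
  assumes "1 < p" "0 \<le> a" "0 \<le> b" "0 < \<theta>" "\<theta> < 1"
  shows "(a + b) powr p \<le> (1 - \<theta>) powr (1 - p) * a powr p + \<theta> powr (1 - p) * b powr p"
proof -
  have *: "t * (c / t) powr p = t powr (1 - p) * c powr p" if "0 < t" "0 \<le> c" for t c :: real
    using that by (auto simp: powr_divide powr_diff)
  consider "a = 0" | "b = 0" | "a > 0" "b > 0" using assms by linarith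
  then show ?thesis
  proof cases
    case 1
    have "1 powr (1 - p) \<le> \<theta> powr (1 - p)" using assms by (intro powr_mono2') auto
    then show ?thesis using 1 assms mult_right_mono[of 1 "\<theta> powr (1 - p)" "b powr p"] by simp
  next
    case 2
    have "1 powr (1 - p) \<le> (1 - \<theta>) powr (1 - p)" using assms by (intro powr_mono2') auto
    then show ?thesis using 2 assms mult_right_mono[of 1 "(1 - \<theta>) powr (1 - p)" "a powr p"] by simp
  next
    case 3
    have "((1 - \<theta>) *\<^sub>R (a / (1 - \<theta>)) + \<theta> *\<^sub>R (b / \<theta>)) powr p
        \<le> (1 - \<theta>) * (a / (1 - \<theta>)) powr p + \<theta> * (b / \<theta>) powr p"
      using 3 assms by (intro convex_onD[OF powr_convex]) auto
    then show ?thesis using assms by (simp add: *)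
  qed
qed

lemma Young_powr:
  fixes a b p :: real
  assumes "1 < p" "0 \<le> a" "0 \<le> b"
  shows "p * (a powr (p - 1) * b) \<le> (p - 1) * a powr p + b powr p"
proof -
  have "a powr (p - 1) * b \<le> (a powr (p - 1)) powr (p / (p - 1)) / (p / (p - 1)) + b powr p / p"
    using assms by (intro Youngs_inequality) (auto simp: field_simps)
  also have "(a powr (p - 1)) powr (p / (p - 1)) = a powr p"
    using assms by (simp add: powr_powr)
  also have "a powr p / (p / (p - 1)) + b powr p / p = ((p - 1) * a powr p + b powr p) / p"
    using assms by (simp add: field_simps)
  finally show ?thesis using assms by (simp add: field_simps)
qed

section \<open>Monotonicity along rays\<close>

lemma loc_lipschitz_on_imp_continuous_on:
  assumes "loc_lipschitz_on S f"
  shows "continuous_on S f"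
  unfolding continuous_on_eq_continuous_within
proof
  fix x assume "x \<in> S"
  then obtain e L where e: "e > 0" "L-lipschitz_on (ball x e \<inter> S) f"
    using assms by (auto simp: loc_lipschitz_on_def)
  then have "continuous (at x within ball x e \<inter> S) f"
    using \<open>x \<in> S\<close> by (auto dest!: lipschitz_on_continuous_on simp: continuous_on_eq_continuous_within)
  moreover have "at x within ball x e \<inter> S = at x within S"
    using e by (intro at_within_nhd[of _ "ball x e"]) auto
  ultimately show "continuous (at x within S) f" by (simp add: continuous_within)
qed

lemma loc_lipschitz_on_compact:
  assumes "loc_lipschitz_on U f" "compact K" "K \<subseteq> U"
  obtains L where "L-lipschitz_on K f"
proof -
  \<comment> \<open>\<open>local_lipschitz\<close> speaks of families of functions. Over the
    one-point time set {0} the family is just f, and the compactness result for families yields a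
    single constant on all of K.\<close>
  have "local_lipschitz {0::real} K (\<lambda>_. f)"
  proof (rule local_lipschitzI)
    fix x assume "x \<in> K"
    then obtain e L where e: "e > 0" "L-lipschitz_on (ball x e \<inter> U) f"
      using assms(1,3) unfolding loc_lipschitz_on_def by blast
    have "L-lipschitz_on (cball x (e / 2) \<inter> K) f"
      by (rule lipschitz_on_subset[OF e(2)]) (use e(1) assms(3) in auto)
    then show "\<exists>u>0. \<exists>L. \<forall>t\<in>cball t u \<inter> {0::real}. L-lipschitz_on (cball x u \<inter> K) f" for t
      using e(1) by (intro exI[of _ "e / 2"]) auto
  qed
  then show ?thesis
    using local_lipschitz_compact_implies_lipschitz[of "{0::real}" K "\<lambda>_. f"] assms(2) that by auto
qed

text \<open>Differentiable images of null sets are null, here under the inverse dilation. It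
  transports information about the gradient at t x to almost every x.\<close>

lemma AE_lebesgue_scaleR:
  fixes P :: "'a::euclidean_space \<Rightarrow> bool"
  assumes "AE x in lebesgue. P x" "t \<noteq> 0"
  shows "AE x in lebesgue. P (t *\<^sub>R x)"
proof -
  from assms(1) obtain N where N: "{x. \<not> P x} \<subseteq> N" "N \<in> null_sets lebesgue"
    by (auto simp: eventually_ae_filter)
  then have "negligible ((\<lambda>x. (1 / t) *\<^sub>R x) ` N)"
    by (intro negligible_differentiable_image_negligible)
      (auto simp: negligible_iff_null_sets intro!: derivative_intros)
  moreover have "{x. \<not> P (t *\<^sub>R x)} \<subseteq> (\<lambda>x. (1 / t) *\<^sub>R x) ` N"
  proof
    fix x assume "x \<in> {x. \<not> P (t *\<^sub>R x)}"
    then show "x \<in> (\<lambda>x. (1 / t) *\<^sub>R x) ` N"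
      using N(1) assms(2) by (intro image_eqI[of _ _ "t *\<^sub>R x"]) auto
  qed
  ultimately show ?thesis
    by (auto simp: eventually_ae_filter negligible_iff_null_sets)
qed

lemma GDERIV_ray:
  assumes "GDERIV f (t *\<^sub>R x) :> D"
  shows "((\<lambda>s. f (s *\<^sub>R x)) has_real_derivative x \<bullet> D) (at t)"
proof -
  have "((\<lambda>s. s *\<^sub>R x) has_derivative (\<lambda>h. h *\<^sub>R x)) (at t)"
    by (auto intro!: derivative_eq_intros)
  from diff_chain_at[OF this assms[unfolded gderiv_def]]
  have "((\<lambda>s. f (s *\<^sub>R x)) has_derivative (\<lambda>h. h * (x \<bullet> D))) (at t)"
    by (simp add: o_def)
  moreover have "(\<lambda>h. h * (x \<bullet> D)) = (*) (x \<bullet> D)" by (simp add: fun_eq_iff)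
  ultimately show ?thesis by (simp only: has_field_derivative_def)
qed

text \<open>Averaging over a ball makes the derivative along the rays exist, which it need not do on an
  individual ray, since the gradient is only known almost everywhere.\<close>

lemma nonincreasing_along_rays:
  fixes f :: "'a::euclidean_space \<Rightarrow> real"
  assumes U: "open U" and lip: "loc_lipschitz_on U f"
    and D: "AE x in lebesgue_on U. \<exists>D. GDERIV f x :> D \<and> x \<bullet> D \<le> 0"
    and T: "1 \<le> T" and ray: "\<And>t. t \<in> {1..T} \<Longrightarrow> t *\<^sub>R x0 \<in> U"
  shows "f (T *\<^sub>R x0) \<le> f x0"
proof (rule ccontr)
  assume less: "\<not> f (T *\<^sub>R x0) \<le> f x0"
  have seg: "compact ((\<lambda>t. t *\<^sub>R x0) ` {1..T})"
    by (intro compact_continuous_image continuous_intros) auto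
  have "(\<lambda>t. t *\<^sub>R x0) ` {1..T} \<subseteq> U" using ray by auto
  with seg U obtain e where e: "e > 0" "(\<Union>x\<in>(\<lambda>t. t *\<^sub>R x0) ` {1..T}. cball x e) \<subseteq> U"
    by (rule compact_subset_open_imp_cball_epsilon_subset)
  \<comment> \<open>Dilation by at most T stretches a ball of radius e / T to radius at most e, so
    all dilates of \<open>cball x0 r\<close> stay in the tube of radius e around the
    segment.\<close>
  define r where "r = e / T"
  have r: "r > 0" using e T by (simp add: r_def)
  define K where "K = (\<lambda>(t, x). t *\<^sub>R x) ` ({1..T} \<times> cball x0 r)"
  have KI: "t *\<^sub>R x \<in> K" if "t \<in> {1..T}" "x \<in> cball x0 r" for t x
    using that by (auto simp: K_def)
  have "compact K"
    unfolding K_def case_prod_beta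
    by (intro compact_continuous_image compact_Times continuous_intros) auto
  have "K \<subseteq> U"
  proof
    fix y assume "y \<in> K"
    then obtain t x where tx: "y = t *\<^sub>R x" "t \<in> {1..T}" "x \<in> cball x0 r" by (auto simp: K_def)
    have "dist (t *\<^sub>R x0) y = \<bar>t\<bar> * dist x0 x"
      by (simp add: tx dist_norm flip: scaleR_diff_right)
    also have "\<dots> \<le> T * r" using tx T by (intro mult_mono) auto
    also have "\<dots> = e" using T by (simp add: r_def)
    finally have "y \<in> cball (t *\<^sub>R x0) e" by simp
    then show "y \<in> U" using e(2) tx(2) by blast
  qed
  then obtain L where L: "L-lipschitz_on K f"
    using loc_lipschitz_on_compact[OF lip \<open>compact K\<close>] by auto
  have contK: "continuous_on K f" using L by (rule lipschitz_on_continuous_on)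
  have contt: "continuous_on (cball x0 r) (\<lambda>x. f (t *\<^sub>R x))" if "t \<in> {1..T}" for t
    using KI that by (intro continuous_on_compose2[OF contK]) (auto intro!: continuous_intros)
  have "continuous_on (cball x0 r) (\<lambda>x. f (T *\<^sub>R x) - f (1 *\<^sub>R x))"
    using T by (intro continuous_intros contt) auto
  then have "isCont (\<lambda>x. f (T *\<^sub>R x) - f (1 *\<^sub>R x)) x0"
    using r by (intro continuous_on_interior[of "cball x0 r"]) auto
  then have "\<forall>\<^sub>F x in at x0. 0 < f (T *\<^sub>R x) - f (1 *\<^sub>R x)"
    using less by (intro order_tendstoD(1)[of _ "f (T *\<^sub>R x0) - f (1 *\<^sub>R x0)"]) (auto simp: isCont_def)
  then obtain d where d: "d > 0" "\<And>x. x \<noteq> x0 \<Longrightarrow> dist x x0 < d \<Longrightarrow> 0 < f (T *\<^sub>R x) - f (1 *\<^sub>R x)"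
    by (auto simp: eventually_at)
  \<comment> \<open>By continuity the assumed increase from x0 to T x0 persists on a whole ball.
    Integrated over it, this gives \<Phi> 1 < \<Phi> T and contradicts the monotonicity of the
    average \<Phi>. The radius d / 2 is used since the ball is closed and the condition involving d
    is strict.\<close>
  define B where "B = cball x0 (min r (d / 2))"
  have Br: "B \<subseteq> cball x0 r" by (auto simp: B_def)
  have Bpos: "f (1 *\<^sub>R x) < f (T *\<^sub>R x)" if "x \<in> B" for x
    using d(2)[of x] that d(1) r less by (cases "x = x0") (auto simp: B_def dist_commute)
  have B[measurable]: "B \<in> sets lebesgue" "B \<in> lmeasurable" by (auto simp: B_def)
  interpret finite_measure "lebesgue_on B" using B by (intro finite_measure_lebesgue_on)
  define C where "C = L * (norm x0 + r)"
  have C: "\<bar>f (s *\<^sub>R x) - f (t *\<^sub>R x)\<bar> \<le> C * \<bar>s - t\<bar>"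
    if "x \<in> B" "s \<in> {1..T}" "t \<in> {1..T}" for x s t
  proof -
    have "\<bar>f (s *\<^sub>R x) - f (t *\<^sub>R x)\<bar> \<le> L * dist (s *\<^sub>R x) (t *\<^sub>R x)"
      using lipschitz_onD[OF L KI KI, of s x t x] that Br by (auto simp: dist_real_def)
    also have "dist (s *\<^sub>R x) (t *\<^sub>R x) = norm x * \<bar>s - t\<bar>"
      by (simp add: dist_norm flip: scaleR_diff_left)
    also have "L * (norm x * \<bar>s - t\<bar>) \<le> L * ((norm x0 + r) * \<bar>s - t\<bar>)"
    proof (intro mult_left_mono mult_right_mono)
      have "norm x \<le> norm x0 + dist x0 x" by (metis dist_commute dist_norm norm_triangle_sub)
      then show "norm x \<le> norm x0 + r" using Br that by fastforce
    qed (use lipschitz_on_nonneg[OF L] in auto)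
    finally show ?thesis by (simp add: C_def mult.assoc)
  qed
  have meas: "(\<lambda>x. f (t *\<^sub>R x)) \<in> borel_measurable (lebesgue_on B)" if "t \<in> {1..T}" for t
    by (intro continuous_imp_measurable_on_sets_lebesgue B continuous_on_subset[OF contt[OF that] Br])
  have int: "integrable (lebesgue_on B) (\<lambda>x. f (t *\<^sub>R x))" if "t \<in> {1..T}" for t
  proof -
    have "bounded ((\<lambda>x. f (t *\<^sub>R x)) ` cball x0 r)"
      by (intro compact_imp_bounded compact_continuous_image contt that) auto
    then obtain M where "\<And>x. x \<in> B \<Longrightarrow> norm (f (t *\<^sub>R x)) \<le> M"
      using Br by (auto simp: bounded_iff)
    then show ?thesis
      using meas[OF that] by (intro integrable_const_bound[where B = M]) auto
  qed
  define \<Phi> where "\<Phi> t = (\<integral>x. f (t *\<^sub>R x) \<partial>lebesgue_on B)" for t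
  have "\<Phi> T \<le> \<Phi> 1"
  proof (rule DERIV_nonpos_imp_decreasing_open[OF T])
    have "(measure (lebesgue_on B) (space (lebesgue_on B)) * C)-lipschitz_on {1..T} \<Phi>"
    proof (rule lipschitz_onI)
      fix s t assume st: "s \<in> {1..T}" "t \<in> {1..T}"
      have "\<bar>\<Phi> s - \<Phi> t\<bar> = \<bar>\<integral>x. f (s *\<^sub>R x) - f (t *\<^sub>R x) \<partial>lebesgue_on B\<bar>"
        using int st by (simp add: \<Phi>_def)
      also have "\<dots> \<le> (\<integral>x. \<bar>f (s *\<^sub>R x) - f (t *\<^sub>R x)\<bar> \<partial>lebesgue_on B)"
        by (rule integral_abs_bound)
      also have "\<dots> \<le> (\<integral>x. C * \<bar>s - t\<bar> \<partial>lebesgue_on B)"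
        using C st int by (intro integral_mono) auto
      finally show "dist (\<Phi> s) (\<Phi> t) \<le> measure (lebesgue_on B) (space (lebesgue_on B)) * C * dist s t"
        by (simp add: dist_real_def mult_ac)
    qed (use lipschitz_on_nonneg[OF L] r in \<open>auto simp: C_def\<close>)
    then show "continuous_on {1..T} \<Phi>" by (rule lipschitz_on_continuous_on)
  next
    fix t assume t: "1 < t" "t < T"
    then have tT: "t \<in> {1..T}" by auto
    define Q where "Q s x = (f (s *\<^sub>R x) - f (t *\<^sub>R x)) / (s - t)" for s x
    define X0 where "X0 m = t + (T - t) / real (Suc m)" for m
    have X0: "X0 m \<in> {1..T} - {t}" for m
    proof -
      define y where "y = (T - t) / real (Suc m)"
      have "y \<le> (T - t) / 1" unfolding y_def using t by (intro divide_left_mono) auto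
      moreover have "y > 0" unfolding y_def using t by simp
      ultimately show ?thesis using t unfolding X0_def y_def[symmetric] by auto
    qed
    have "X0 \<longlonglongrightarrow> t + (T - t) * 0"
      unfolding X0_def divide_inverse by (intro tendsto_intros LIMSEQ_inverse_real_of_nat)
    then have X0lim: "X0 \<longlonglongrightarrow> t" by simp
    \<comment> \<open>The radial derivative exists only almost everywhere. Taking the limit along
      one fixed sequence gives a function that is measurable everywhere and equals the derivative
      wherever that exists.\<close>
    define R where "R x = lim (\<lambda>m. Q (X0 m) x)" for x
    have Qm: "(\<lambda>x. Q s x) \<in> borel_measurable (lebesgue_on B)" if "s \<in> {1..T}" for s
      unfolding Q_def using meas that tT by (intro borel_measurable_divide borel_measurable_diff) auto
    have Rm: "R \<in> borel_measurable (lebesgue_on B)"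
      unfolding R_def using X0 Qm by (intro borel_measurable_lim_metric) auto
    \<comment> \<open>For fixed t the points x at which f has no gradient at t x form a null set.
      This set may vary with t, but the integral over B ignores it each time, so \<Phi> is
      differentiable at every interior t.\<close>
    have "AE x in lebesgue. x \<in> U \<longrightarrow> (\<exists>D. GDERIV f x :> D \<and> x \<bullet> D \<le> 0)"
      using D U by (subst (asm) AE_restrict_space_iff) auto
    from AE_lebesgue_scaleR[OF this, of t] t
    have "AE x in lebesgue. t *\<^sub>R x \<in> U \<longrightarrow> (\<exists>D. GDERIV f (t *\<^sub>R x) :> D \<and> t *\<^sub>R x \<bullet> D \<le> 0)"
      by simp
    then have "AE x in lebesgue. x \<in> B \<longrightarrow> ((\<lambda>s. Q s x) \<longlongrightarrow> R x) (at t within {1..T}) \<and> R x \<le> 0"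
    proof eventually_elim
      case (elim x)
      show ?case
      proof
        assume "x \<in> B"
        then have "t *\<^sub>R x \<in> U" using KI[OF tT] Br \<open>K \<subseteq> U\<close> by blast
        with elim obtain D where D: "GDERIV f (t *\<^sub>R x) :> D" "t *\<^sub>R x \<bullet> D \<le> 0" by auto
        have "((\<lambda>s. Q s x) \<longlongrightarrow> x \<bullet> D) (at t within {1..T})"
          using has_field_derivative_at_within[OF GDERIV_ray[OF D(1)]]
          by (simp add: Q_def has_field_derivative_iff)
        moreover from this have "(\<lambda>m. Q (X0 m) x) \<longlonglongrightarrow> x \<bullet> D"
          unfolding tendsto_at_iff_sequentially using X0 X0lim by (auto simp: o_def)
        then have "R x = x \<bullet> D" unfolding R_def by (rule limI)
        moreover have "x \<bullet> D \<le> 0" using D(2) t by (simp add: mult_le_0_iff)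
        ultimately show "((\<lambda>s. Q s x) \<longlongrightarrow> R x) (at t within {1..T}) \<and> R x \<le> 0" by simp
      qed
    qed
    then have R: "AE x in lebesgue_on B. ((\<lambda>s. Q s x) \<longlongrightarrow> R x) (at t within {1..T}) \<and> R x \<le> 0"
      using B by (subst AE_restrict_space_iff) auto
    have "((\<lambda>s. (\<Phi> s - \<Phi> t) / (s - t)) \<longlongrightarrow> (\<integral>x. R x \<partial>lebesgue_on B)) (at t within {1..T})"
      unfolding tendsto_at_iff_sequentially
    proof safe
      fix X assume X: "\<forall>i. X i \<in> {1..T} - {t}" "X \<longlonglongrightarrow> t"
      have "(\<lambda>i. \<integral>x. Q (X i) x \<partial>lebesgue_on B) \<longlonglongrightarrow> (\<integral>x. R x \<partial>lebesgue_on B)"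
      proof (rule integral_dominated_convergence[where w = "\<lambda>_. C"])
        show "AE x in lebesgue_on B. (\<lambda>i. Q (X i) x) \<longlonglongrightarrow> R x"
          using R by eventually_elim (use X in \<open>auto simp: tendsto_at_iff_sequentially o_def\<close>)
        show "AE x in lebesgue_on B. norm (Q (X i) x) \<le> C" for i
        proof (rule AE_I2)
          fix x assume "x \<in> space (lebesgue_on B)"
          then have "\<bar>f (X i *\<^sub>R x) - f (t *\<^sub>R x)\<bar> \<le> C * \<bar>X i - t\<bar>"
            using X tT by (intro C) auto
          then show "norm (Q (X i) x) \<le> C"
            using X by (auto simp: Q_def abs_divide divide_simps)
        qed
      qed (use X Qm Rm in auto)
      moreover have "(\<integral>x. Q (X i) x \<partial>lebesgue_on B) = (\<Phi> (X i) - \<Phi> t) / (X i - t)" for i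
        using int X tT by (simp add: Q_def \<Phi>_def)
      ultimately show "((\<lambda>s. (\<Phi> s - \<Phi> t) / (s - t)) \<circ> X) \<longlonglongrightarrow> (\<integral>x. R x \<partial>lebesgue_on B)"
        by (simp add: o_def)
    qed
    then have "(\<Phi> has_real_derivative (\<integral>x. R x \<partial>lebesgue_on B)) (at t)"
      using t by (simp add: has_field_derivative_iff at_within_Icc_at)
    moreover have "(\<integral>x. R x \<partial>lebesgue_on B) \<le> 0"
      using R integral_nonneg_AE[of "\<lambda>x. - R x" "lebesgue_on B"] by (auto elim!: eventually_mono)
    ultimately show "\<exists>y. (\<Phi> has_real_derivative y) (at t) \<and> y \<le> 0" by blast
  qed
  moreover have "\<Phi> 1 < \<Phi> T"
    unfolding \<Phi>_def
  proof (rule integral_less_AE_space)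
    have "\<not> negligible B"
      using r d open_not_negligible[of "ball x0 (min r (d / 2))"]
        negligible_subset[of B "ball x0 (min r (d / 2))"] by (auto simp: B_def)
    then show "emeasure (lebesgue_on B) (space (lebesgue_on B)) \<noteq> 0"
      using B by (auto simp: negligible_iff_null_sets null_sets_def emeasure_restrict_space)
  qed (use int[of 1] int[of T] T Bpos in auto)
  ultimately show False by simp
qed

text \<open>Continuity turns the almost everywhere inequality into |y| \<le> f y everywhere.
  Strictness is regained by moving a little outwards along the ray: |x| < |T x| \<le> f(T x) \<le> f
  x. The origin is covered by positivity.\<close>

lemma norm_less_of_radial:
  fixes f :: "'a::euclidean_space \<Rightarrow> real"
  assumes U: "open U" and lip: "loc_lipschitz_on U f" and pos: "\<forall>x\<in>U. 0 < f x"
    and D: "AE x in lebesgue_on U. norm x < f x \<and> (\<exists>D. GDERIV f x :> D \<and> x \<bullet> D \<le> 0)"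
    and x: "x \<in> U"
  shows "norm x < f x"
proof (cases "x = 0")
  case False
  have cont: "continuous_on U f" using lip by (rule loc_lipschitz_on_imp_continuous_on)
  have le: "norm y \<le> f y" if "y \<in> U" for y
  proof (rule ccontr)
    assume "\<not> norm y \<le> f y"
    have "open (U \<inter> (\<lambda>y. norm y - f y) -` {0<..})"
      using U cont by (intro continuous_open_preimage continuous_intros) auto
    moreover have "y \<in> U \<inter> (\<lambda>y. norm y - f y) -` {0<..}"
      using that \<open>\<not> norm y \<le> f y\<close> by auto
    ultimately have "\<not> negligible (U \<inter> (\<lambda>y. norm y - f y) -` {0<..})"
      by (intro open_not_negligible) auto
    moreover have "AE x in lebesgue. x \<notin> U \<inter> (\<lambda>y. norm y - f y) -` {0<..}"
      using D U by (subst (asm) AE_restrict_space_iff) (auto elim!: eventually_mono)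
    ultimately show False
      using \<open>open (U \<inter> _)\<close> by (auto simp: negligible_iff_null_sets AE_iff_null_sets)
  qed
  obtain e where e: "e > 0" "ball x e \<subseteq> U" using U x by (auto simp: open_contains_ball)
  \<comment> \<open>With this choice the point moves by exactly e / 2, hence inside the ball of
    radius e.\<close>
  define T where "T = 1 + e / (2 * norm x)"
  have T: "1 < T" using e False by (simp add: T_def)
  have ray: "t *\<^sub>R x \<in> U" if "t \<in> {1..T}" for t
  proof -
    have "dist x (t *\<^sub>R x) = norm ((t - 1) *\<^sub>R x)"
      by (simp add: dist_norm norm_minus_commute scaleR_diff_left)
    also have "\<dots> \<le> (T - 1) * norm x" using that by (auto intro: mult_right_mono)
    also have "\<dots> < e" using e False by (simp add: T_def)
    finally show ?thesis using e by auto
  qed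
  have "norm x < norm (T *\<^sub>R x)" using T False by simp
  also have "\<dots> \<le> f (T *\<^sub>R x)" using T ray by (intro le) auto
  also have "\<dots> \<le> f x"
    using T ray D by (intro nonincreasing_along_rays[OF U lip]) (auto elim!: eventually_mono)
  finally show ?thesis .
qed (use pos x in auto)

section \<open>Gradients, dilations and parameter integrals\<close>

lemma g_fun_identity:
  assumes "0 < s"
  shows "k * g_fun k s + s powr k = 1"
  using assms by (auto simp: g_fun_def)

lemma grad_eq:
  assumes "GDERIV f x :> D"
  shows "grad f x = D"
  unfolding grad_def
proof (rule the_equality)
  fix D' assume "GDERIV f x :> D'"
  with assms have "(\<lambda>h. h \<bullet> D') = (\<lambda>h. h \<bullet> D)"
    unfolding gderiv_def by (rule has_derivative_unique[rotated])
  then have "h \<bullet> D' = h \<bullet> D" for h by (rule fun_cong)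
  then show "D' = D" using vector_eq_ldot[of D' D] by blast
qed (rule assms)

lemma
  fixes f :: "'a::euclidean_space \<Rightarrow> real"
  assumes "Ck (Suc 0) f"
  shows Ck_imp_GDERIV: "GDERIV f x :> grad f x"
    and Ck_imp_continuous_on_grad: "continuous_on A (grad f)"
proof -
  let ?D = "\<lambda>x. \<Sum>b\<in>Basis. frechet_derivative f (at x) b *\<^sub>R b"
  have D: "GDERIV f x :> ?D x" for x
  proof -
    have *: "(f has_derivative frechet_derivative f (at x)) (at x)"
      using assms by (simp add: frechet_derivative_works[symmetric])
    have "frechet_derivative f (at x) h = h \<bullet> ?D x" for h
    proof -
      have "frechet_derivative f (at x) h = frechet_derivative f (at x) (\<Sum>b\<in>Basis. (h \<bullet> b) *\<^sub>R b)"
        by (simp add: euclidean_representation)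
      also have "\<dots> = (\<Sum>b\<in>Basis. (h \<bullet> b) * frechet_derivative f (at x) b)"
        using has_derivative_linear[OF *] by (simp add: linear_sum linear_scale)
      finally show ?thesis by (simp add: inner_sum_right mult.commute)
    qed
    then have "frechet_derivative f (at x) = (\<lambda>h. h \<bullet> ?D x)" by (rule ext)
    with * show ?thesis by (simp only: gderiv_def)
  qed
  then have eq: "grad f x = ?D x" for x by (rule grad_eq)
  show "GDERIV f x :> grad f x" unfolding eq by (rule D)
  have "continuous_on UNIV ?D"
    using assms by (intro continuous_intros) auto
  moreover have "grad f = ?D" using eq by (rule ext)
  ultimately have "continuous_on UNIV (grad f)" by (simp only:)
  then show "continuous_on A (grad f)" by (rule continuous_on_subset) simp
qed

lemma
  fixes f :: "'a::euclidean_space \<Rightarrow> 'b::{banach, second_countable_topology}"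
  assumes f: "integrable lborel f" and t: "0 < t"
  shows integrable_lborel_scaleR: "integrable lborel (\<lambda>x. f (t *\<^sub>R x))"
    and integral_lborel_scaleR:
      "(\<integral>x. f x \<partial>lborel) = t ^ DIM('a) *\<^sub>R (\<integral>x. f (t *\<^sub>R x) \<partial>lborel)"
proof -
  have eq: "lborel = density (distr lborel borel (\<lambda>x::'a. 0 + t *\<^sub>R x)) (\<lambda>_. \<bar>t\<bar> ^ DIM('a))"
    using t by (intro lborel_affine) auto
  have m[measurable]: "f \<in> borel_measurable borel" using f by auto
  have "integrable (density (distr lborel borel (\<lambda>x::'a. 0 + t *\<^sub>R x)) (\<lambda>_. \<bar>t\<bar> ^ DIM('a))) f"
    using f eq by simp
  then show "integrable lborel (\<lambda>x. f (t *\<^sub>R x))"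
    using t integrable_scaleR_right[of "1 / t ^ DIM('a)" lborel "\<lambda>x. t ^ DIM('a) *\<^sub>R f (t *\<^sub>R x)"]
    by (subst (asm) integrable_density) (auto simp: integrable_distr_eq)
  have "(\<integral>x. f x \<partial>lborel)
      = (\<integral>x. f x \<partial>density (distr lborel borel (\<lambda>x::'a. 0 + t *\<^sub>R x)) (\<lambda>_. \<bar>t\<bar> ^ DIM('a)))"
    using eq by simp
  also have "\<dots> = t ^ DIM('a) *\<^sub>R (\<integral>x. f (t *\<^sub>R x) \<partial>lborel)"
    using t by (subst integral_density) (auto simp: integral_distr)
  finally show "(\<integral>x. f x \<partial>lborel) = t ^ DIM('a) *\<^sub>R (\<integral>x. f (t *\<^sub>R x) \<partial>lborel)" .
qed

text \<open>The parameter integral is maximal at the left endpoint, so its difference quotients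
  there are nonpositive. They converge to the integral of F' a by dominated convergence; the mean
  value theorem and the bound of F' on the compact set {a..b} \<times> E supply the constant
  majorant.\<close>

lemma set_integral_derivative_nonpos:
  fixes F F' :: "real \<Rightarrow> 'a::euclidean_space \<Rightarrow> real"
  assumes E: "compact E" and ab: "a < b"
    and F': "continuous_on ({a..b} \<times> E) (\<lambda>z. F' (fst z) (snd z))"
    and D: "\<And>t x. t \<in> {a..b} \<Longrightarrow> x \<in> E \<Longrightarrow> ((\<lambda>t. F t x) has_real_derivative F' t x) (at t)"
    and F: "\<And>t. t \<in> {a..b} \<Longrightarrow> continuous_on E (F t)"
    and le: "\<And>t. t \<in> {a..b} \<Longrightarrow> (LINT x:E|lborel. F t x) \<le> (LINT x:E|lborel. F a x)"
  shows "(LINT x:E|lborel. F' a x) \<le> 0"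
proof -
  have "bounded ((\<lambda>z. F' (fst z) (snd z)) ` ({a..b} \<times> E))"
    by (intro compact_imp_bounded compact_continuous_image F' compact_Times E) auto
  then obtain C where *: "\<forall>z\<in>{a..b} \<times> E. \<bar>F' (fst z) (snd z)\<bar> \<le> C"
    by (auto simp: bounded_iff)
  have C: "\<bar>F' t x\<bar> \<le> C" if "t \<in> {a..b}" "x \<in> E" for t x
    using bspec[OF *, of "(t, x)"] that by simp
  have int: "set_integrable lborel E (F t)" if "t \<in> {a..b}" for t
    unfolding set_integrable_def by (intro borel_integrable_compact E F that)
  define X where "X m = a + (b - a) / real (Suc m)" for m
  have X: "X m \<in> {a<..b}" for m
  proof -
    define y where "y = (b - a) / real (Suc m)"
    have "y \<le> (b - a) / 1" unfolding y_def using ab by (intro divide_left_mono) auto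
    moreover have "y > 0" unfolding y_def using ab by simp
    ultimately show ?thesis unfolding X_def y_def[symmetric] by auto
  qed
  have "X \<longlonglongrightarrow> a + (b - a) * 0"
    unfolding X_def divide_inverse by (intro tendsto_intros LIMSEQ_inverse_real_of_nat)
  then have Xlim: "X \<longlonglongrightarrow> a" by simp
  define Q where "Q m x = (F (X m) x - F a x) / (X m - a)" for m x
  have Qint: "set_integrable lborel E (Q m)" for m
  proof -
    have "set_integrable lborel E (\<lambda>x. F (X m) x - F a x)"
      using int[of "X m"] int[of a] X[of m] ab by (intro set_integral_diff(1)) auto
    then show ?thesis unfolding Q_def by (rule set_integrable_divide)
  qed
  have F'int: "set_integrable lborel E (F' a)"
    unfolding set_integrable_def
  proof (intro borel_integrable_compact E)
    have "continuous_on E (\<lambda>x. (a, x))" by (intro continuous_intros)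
    from continuous_on_compose2[OF F' this] show "continuous_on E (F' a)"
      using ab by (simp add: image_subset_iff)
  qed
  have lim: "(\<lambda>m. LINT x:E|lborel. Q m x) \<longlonglongrightarrow> (LINT x:E|lborel. F' a x)"
    unfolding set_lebesgue_integral_def
  proof (rule integral_dominated_convergence[where w = "\<lambda>x. indicator E x *\<^sub>R C"])
    show "integrable lborel (\<lambda>x. indicator E x *\<^sub>R C)"
      by (intro borel_integrable_compact E continuous_intros)
    show "AE x in lborel. (\<lambda>m. indicator E x *\<^sub>R Q m x) \<longlonglongrightarrow> indicator E x *\<^sub>R F' a x"
    proof (rule AE_I2)
      fix x
      show "(\<lambda>m. indicator E x *\<^sub>R Q m x) \<longlonglongrightarrow> indicator E x *\<^sub>R F' a x"
      proof (cases "x \<in> E")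
        case True
        then have "((\<lambda>t. (F t x - F a x) / (t - a)) \<longlongrightarrow> F' a x) (at a)"
          using D[of a x] ab by (simp add: has_field_derivative_iff)
        moreover have "X m \<noteq> a" for m using X[of m] by auto
        then have "filterlim X (at a) sequentially" using Xlim by (simp add: filterlim_at)
        ultimately have "(\<lambda>m. Q m x) \<longlonglongrightarrow> F' a x"
          unfolding Q_def by (rule filterlim_compose)
        then show ?thesis using True by simp
      qed simp
    qed
    show "AE x in lborel. norm (indicator E x *\<^sub>R Q m x) \<le> indicator E x *\<^sub>R C" for m
    proof (rule AE_I2)
      fix x
      have "\<bar>Q m x\<bar> \<le> C" if "x \<in> E"
      proof -
        have "\<exists>z>a. z < X m \<and> F (X m) x - F a x = (X m - a) * F' z x"
          by (rule MVT2) (use X[of m] D[of _ x] that in auto)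
        then obtain z where z: "a < z" "z < X m" "F (X m) x - F a x = (X m - a) * F' z x"
          by blast
        then have "Q m x = F' z x" by (simp add: Q_def)
        then show ?thesis using C[of z x] z X[of m] that by auto
      qed
      then show "norm (indicator E x *\<^sub>R Q m x) \<le> indicator E x *\<^sub>R C"
        by (auto simp: indicator_def)
    qed
  qed (use Qint F'int in \<open>auto simp: set_integrable_def\<close>)
  have "(LINT x:E|lborel. Q m x) \<le> 0" for m
  proof -
    have "(LINT x:E|lborel. Q m x) = (LINT x:E|lborel. F (X m) x - F a x) / (X m - a)"
      unfolding Q_def by (rule set_integral_divide_zero)
    also have "(LINT x:E|lborel. F (X m) x - F a x)
        = (LINT x:E|lborel. F (X m) x) - (LINT x:E|lborel. F a x)"
      using int[of "X m"] int[of a] X[of m] ab by (intro set_integral_diff(2)) auto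
    finally show ?thesis using le[of "X m"] X[of m] by (auto simp: divide_le_0_iff)
  qed
  then show ?thesis by (intro LIMSEQ_le_const2[OF lim]) auto
qed

section \<open>The inequality for test functions\<close>

text \<open>It is used with a = \<alpha>p and q = \<beta>p - 1. For the field X = x |x|^(-a) g^(-q)
  the integrand is the lower bound for div(|\<phi>|^p X): the first summand bounds |\<phi>|^p div X
  from below, the second is the inner product of X with the gradient of |\<phi>|^p.\<close>

lemma hardy_dilation:
  fixes lam \<phi> :: "'a::euclidean_space \<Rightarrow> real" and D\<phi> :: "'a \<Rightarrow> 'a"
  assumes \<Omega>: "open \<Omega>" and lam: "continuous_on \<Omega> lam"
    and less: "\<And>x. x \<in> \<Omega> \<Longrightarrow> norm x < lam x"
    and mono: "\<And>x t. 1 \<le> t \<Longrightarrow> (\<And>s. s \<in> {1..t} \<Longrightarrow> s *\<^sub>R x \<in> \<Omega>) \<Longrightarrow> lam (t *\<^sub>R x) \<le> lam x"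
    and D\<phi>: "\<And>x. GDERIV \<phi> x :> D\<phi> x" and contD: "continuous_on UNIV D\<phi>"
    and S: "compact S" "S \<subseteq> \<Omega>" "\<And>x. x \<notin> S \<Longrightarrow> \<phi> x = 0"
    and p: "1 < p" and q: "0 < q" and k: "real DIM('a) - a = k * q" and \<epsilon>: "0 < \<epsilon>"
  defines "g \<equiv> \<lambda>x. g_fun k (norm x / lam x)"
  shows "(LINT x:{x\<in>S. \<epsilon> \<le> norm x}|lborel. norm x powr (- a) *
      (q * g x powr (- q - 1) * \<bar>\<phi> x\<bar> powr p +
       g x powr (- q) * (p * (sgn (\<phi> x) * \<bar>\<phi> x\<bar> powr (p - 1)) * (x \<bullet> D\<phi> x)))) \<le> 0"
proof -
  define n where "n = DIM('a)"
  define s where "s x = norm x / lam x" for x :: 'a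
  have g: "g x = g_fun k (s x)" for x by (simp add: g_def s_def)
  obtain \<eta> where \<eta>: "\<eta> > 0" "(\<Union>x\<in>S. cball x \<eta>) \<subseteq> \<Omega>"
    using compact_subset_open_imp_cball_epsilon_subset[OF S(1) \<Omega> S(2)] by blast
  obtain R where R: "R > 0" "\<And>x. x \<in> S \<Longrightarrow> norm x \<le> R"
    using compact_imp_bounded[OF S(1)] by (auto simp: bounded_pos)
  \<comment> \<open>A compact collar of S inside \<Omega>. If t x lies in S and t is close to 1, the
    whole segment from x to t x stays in K, which is what applying \<open>mono\<close>
    requires.\<close>
  define K where "K = {x + y |x y. x \<in> S \<and> y \<in> cball 0 \<eta>}"
  have "compact K" unfolding K_def by (intro compact_sums S) auto
  have KI: "y \<in> K" if "x \<in> S" "dist x y \<le> \<eta>" for x y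
  proof -
    have "y = x + (y - x)" "y - x \<in> cball 0 \<eta>" using that by (auto simp: dist_norm norm_minus_commute)
    then show ?thesis unfolding K_def using that by blast
  qed
  have "S \<subseteq> K" using KI \<eta> by auto
  have "K \<subseteq> \<Omega>"
  proof
    fix z assume "z \<in> K"
    then obtain x y where "z = x + y" "x \<in> S" "norm y \<le> \<eta>" by (auto simp: K_def)
    then have "z \<in> cball x \<eta>" by (simp add: dist_norm)
    then show "z \<in> \<Omega>" using \<eta>(2) \<open>x \<in> S\<close> by blast
  qed
  have lampos: "0 < lam x" if "x \<in> \<Omega>" for x
    using less[OF that] norm_ge_zero[of x] by linarith
  have conts: "continuous_on \<Omega> s"
    unfolding s_def using lam lampos by (intro continuous_intros) fastforce+
  have s1: "s x < 1" if "x \<in> \<Omega>" for x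
    using less[OF that] lampos[OF that] by (simp add: s_def)
  have s0: "0 \<le> s x" if "x \<in> \<Omega>" for x
    using lampos[OF that] by (simp add: s_def)
  \<comment> \<open>The maximum of s over K is strictly below 1 by compactness; this leaves room to
    multiply s by some t > 1 and keep g positive.\<close>
  obtain \<sigma> where \<sigma>: "0 \<le> \<sigma>" "\<sigma> < 1" "\<And>x. x \<in> K \<Longrightarrow> s x \<le> \<sigma>"
  proof (cases "K = {}")
    case False
    then obtain y where y: "y \<in> K" "\<And>x. x \<in> K \<Longrightarrow> s x \<le> s y"
      using continuous_attains_sup[OF \<open>compact K\<close> _ continuous_on_subset[OF conts \<open>K \<subseteq> \<Omega>\<close>]] by blast
    then have "0 \<le> s y" "s y < 1"
      using s1[of y] lampos[of y] \<open>K \<subseteq> \<Omega>\<close> by (auto simp: s_def)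
    with y that show ?thesis by blast
  qed (use that[of 0] in auto)
  \<comment> \<open>The first bound gives \<tau> R \<le> \<eta>, so the segments do not leave the
    collar; the second gives \<tau> < 1 - \<sigma>, so (1 + \<tau>) \<sigma> < 1.\<close>
  define \<tau> where "\<tau> = min (\<eta> / R) ((1 - \<sigma>) / 2)"
  have \<tau>: "0 < \<tau>" "\<tau> * R \<le> \<eta>" "\<tau> < 1 - \<sigma>"
    using \<eta> R \<sigma> by (auto simp: \<tau>_def min_def field_simps)
  define b where "b = 1 + \<tau>"
  have b1: "1 < b" using \<tau> by (simp add: b_def)
  have bs: "t * s x < 1" if "t \<in> {1..b}" "x \<in> K" for t x
  proof -
    have "t * s x \<le> b * \<sigma>"
      using that \<sigma>(1) \<sigma>(3)[OF that(2)] s0 \<open>K \<subseteq> \<Omega>\<close> by (intro mult_mono) auto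
    also have "\<dots> = \<sigma> + \<tau> * \<sigma>" by (simp add: b_def algebra_simps)
    also have "\<tau> * \<sigma> \<le> \<tau> * 1" using \<tau> \<sigma> by (intro mult_left_mono) auto
    finally show ?thesis using \<tau> by simp
  qed
  define E where "E = {x\<in>K. \<epsilon> \<le> norm x}"
  have "closed {x::'a. \<epsilon> \<le> norm x}" by (intro closed_Collect_le continuous_intros)
  moreover have "E = K \<inter> {x. \<epsilon> \<le> norm x}" "{x\<in>S. \<epsilon> \<le> norm x} = S \<inter> {x. \<epsilon> \<le> norm x}"
    by (auto simp: E_def)
  ultimately have cE: "compact E" and cS: "compact {x\<in>S. \<epsilon> \<le> norm x}"
    using \<open>compact K\<close> S(1) by (auto intro: compact_Int_closed)
  have EO: "x \<in> \<Omega>" "x \<in> K" "x \<noteq> 0" "0 < norm x" "0 < s x" if "x \<in> E" for x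
  proof -
    show *: "x \<in> \<Omega>" "x \<in> K" "x \<noteq> 0" "0 < norm x"
      using that \<epsilon> \<open>K \<subseteq> \<Omega>\<close> by (auto simp: E_def)
    show "0 < s x" using lampos[OF *(1)] *(4) by (simp add: s_def)
  qed
  have gpos: "0 < g_fun k (t * s x)" if "t \<in> {1..b}" "x \<in> E" for t x
    using bs[of t x] EO[of x] that by (intro g_fun_pos) auto
  have cont\<phi>: "continuous_on UNIV \<phi>"
    using D\<phi> by (intro continuous_at_imp_continuous_on)
      (auto simp: gderiv_def intro: has_derivative_continuous)
  \<comment> \<open>The dilated integrand with \<open>lam\<close> frozen: t s(x) stands for s(t x),
    and the Jacobian t^n is merged with |t x|^(-a) into t^(n - a) |x|^(-a). Unlike the true
    integrand it is differentiable in t at every point of E.\<close>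
  define F where "F t x = norm x powr (- a) *
    (t powr (n - a) * g_fun k (t * s x) powr (- q) * \<bar>\<phi> (t *\<^sub>R x)\<bar> powr p)" for t x
  define F' where "F' t x = norm x powr (- a) *
    (((n - a) * t powr (n - a - 1) * g_fun k (t * s x) powr (- q) +
      t powr (n - a) * (- q * g_fun k (t * s x) powr (- q - 1) * (- ((t * s x) powr (k - 1)) * s x))) *
      \<bar>\<phi> (t *\<^sub>R x)\<bar> powr p +
     t powr (n - a) * g_fun k (t * s x) powr (- q) *
      (p * (sgn (\<phi> (t *\<^sub>R x)) * \<bar>\<phi> (t *\<^sub>R x)\<bar> powr (p - 1)) * (x \<bullet> D\<phi> (t *\<^sub>R x))))" for t x
  have contg: "continuous_on ({1..b} \<times> E) (\<lambda>z. g_fun k (fst z * s (snd z)))"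
  proof (rule continuous_on_compose2[OF continuous_on_g_fun])
    show "continuous_on ({1..b} \<times> E) (\<lambda>z. fst z * s (snd z))"
      using EO by (intro continuous_intros continuous_on_compose2[OF conts]) auto
    show "(\<lambda>z. fst z * s (snd z)) ` ({1..b} \<times> E) \<subseteq> {0<..}"
      using EO(5) by (auto intro!: mult_pos_pos)
  qed
  have powr_cont: "continuous_on X (\<lambda>z. h z powr c)"
    if "continuous_on X h" "\<And>z. z \<in> X \<Longrightarrow> 0 < h z" for X :: "(real \<times> 'a) set" and h :: "real \<times> 'a \<Rightarrow> real" and c
  proof (intro continuous_on_powr continuous_on_const that(1) ballI)
    show "h z \<noteq> 0" if "z \<in> X" for z using \<open>\<And>z. z \<in> X \<Longrightarrow> 0 < h z\<close>[OF that] by simp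
  qed
  have conts': "continuous_on ({1..b} \<times> E) (\<lambda>z. s (snd z))"
    using EO(1) by (intro continuous_on_compose2[OF conts] continuous_intros) auto
  have cont\<phi>': "continuous_on ({1..b} \<times> E) (\<lambda>z. \<phi> (fst z *\<^sub>R snd z))"
    by (intro continuous_on_compose2[OF cont\<phi>] continuous_intros) auto
  have contD': "continuous_on ({1..b} \<times> E) (\<lambda>z. D\<phi> (fst z *\<^sub>R snd z))"
    by (intro continuous_on_compose2[OF contD] continuous_intros) auto
  have c1: "continuous_on ({1..b} \<times> E) (\<lambda>z. norm (snd z) powr c)" for c
    by (rule powr_cont) (auto intro!: continuous_intros dest: EO(3))
  have c2: "continuous_on ({1..b} \<times> E) (\<lambda>z. fst z powr c)" for c
    by (rule powr_cont) (auto intro!: continuous_intros)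
  have c3: "continuous_on ({1..b} \<times> E) (\<lambda>z. g_fun k (fst z * s (snd z)) powr c)" for c
    by (rule powr_cont[OF contg]) (auto intro: gpos)
  have c4: "continuous_on ({1..b} \<times> E) (\<lambda>z. (fst z * s (snd z)) powr c)" for c
    by (rule powr_cont) (auto intro!: continuous_intros conts' mult_pos_pos dest: EO(5))
  have c5: "continuous_on ({1..b} \<times> E) (\<lambda>z. \<bar>\<phi> (fst z *\<^sub>R snd z)\<bar> powr p)"
    using p by (intro continuous_on_powr' continuous_on_const continuous_on_rabs cont\<phi>') auto
  have c6: "continuous_on ({1..b} \<times> E)
      (\<lambda>z. sgn (\<phi> (fst z *\<^sub>R snd z)) * \<bar>\<phi> (fst z *\<^sub>R snd z)\<bar> powr (p - 1))"
    using p by (intro continuous_on_compose2[OF continuous_on_sgn_abs_powr[of "p - 1"] cont\<phi>']) auto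
  have contF': "continuous_on ({1..b} \<times> E) (\<lambda>z. F' (fst z) (snd z))"
    unfolding F'_def
    by (intro continuous_on_mult continuous_on_add continuous_on_minus continuous_on_const
        continuous_on_inner continuous_on_snd continuous_on_id c1 c2 c3 c4 c5 c6 conts' contD')
  have contF2: "continuous_on ({1..b} \<times> E) (\<lambda>z. F (fst z) (snd z))"
    unfolding F_def by (intro continuous_on_mult c1 c2 c3 c5)
  have contF: "continuous_on E (F t)" if t: "t \<in> {1..b}" for t
  proof -
    have "continuous_on E (\<lambda>x. (t, x))" by (intro continuous_intros)
    from continuous_on_compose2[OF contF2 this] show ?thesis using t by (simp add: image_subset_iff)
  qed
  have derivF: "((\<lambda>t. F t x) has_real_derivative F' t x) (at t)" if tx: "t \<in> {1..b}" "x \<in> E" for t x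
  proof -
    have 1: "((\<lambda>t. t powr (n - a)) has_real_derivative (n - a) * t powr (n - a - 1)) (at t)"
      using tx by (auto intro!: has_real_derivative_powr)
    have "((\<lambda>t. g_fun k (t * s x)) has_real_derivative - ((t * s x) powr (k - 1)) * s x) (at t)"
      using tx EO by (intro DERIV_chain'[OF _ DERIV_g_fun, of "\<lambda>t. t * s x"])
        (auto intro!: derivative_eq_intros)
    then have 2: "((\<lambda>t. g_fun k (t * s x) powr (- q)) has_real_derivative
        - q * g_fun k (t * s x) powr (- q - 1) * (- ((t * s x) powr (k - 1)) * s x)) (at t)"
      using gpos[OF tx] by (intro DERIV_chain'[OF _ has_real_derivative_powr])
    have 3: "((\<lambda>t. \<bar>\<phi> (t *\<^sub>R x)\<bar> powr p) has_real_derivative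
        p * (sgn (\<phi> (t *\<^sub>R x)) * \<bar>\<phi> (t *\<^sub>R x)\<bar> powr (p - 1)) * (x \<bullet> D\<phi> (t *\<^sub>R x))) (at t)"
      by (rule DERIV_chain'[OF GDERIV_ray[OF D\<phi>] DERIV_abs_powr[OF p]])
    show ?thesis
      unfolding F_def F'_def
      by (rule DERIV_cong[OF DERIV_cmult[OF DERIV_mult[OF DERIV_mult[OF 1 2] 3]]])
        (simp add: algebra_simps)
  qed
  \<comment> \<open>Extended by zero to the whole space, where the dilation formula holds. On E it
    agrees with F 1, because \<phi> vanishes off S.\<close>
  define H where "H x = indicator {x\<in>S. \<epsilon> \<le> norm x} x *\<^sub>R
    (norm x powr (- a) * (g_fun k (s x) powr (- q) * \<bar>\<phi> x\<bar> powr p))" for x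
  have H0: "0 \<le> H x" for x by (auto simp: H_def)
  have HF: "H x = indicator E x *\<^sub>R F 1 x" for x
    using \<open>S \<subseteq> K\<close> S(3)[of x] by (auto simp: H_def F_def E_def indicator_def)
  have Hint: "integrable lborel H"
    unfolding HF[abs_def] using b1 by (intro borel_integrable_compact cE contF) auto
  have le: "(LINT x:E|lborel. F t x) \<le> (LINT x:E|lborel. F 1 x)" if t: "t \<in> {1..b}" for t
  proof -
    have "(LINT x:E|lborel. F t x) \<le> (\<integral>x. t ^ n *\<^sub>R H (t *\<^sub>R x) \<partial>lborel)"
      unfolding set_lebesgue_integral_def
    proof (rule integral_mono)
      show "integrable lborel (\<lambda>x. indicator E x *\<^sub>R F t x)"
        by (intro borel_integrable_compact cE contF t)
      show "integrable lborel (\<lambda>x. t ^ n *\<^sub>R H (t *\<^sub>R x))"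
        using t by (intro integrable_scaleR_right integrable_lborel_scaleR Hint) auto
      fix x :: 'a
      show "indicator E x *\<^sub>R F t x \<le> t ^ n *\<^sub>R H (t *\<^sub>R x)"
      proof (cases "x \<in> E \<and> t *\<^sub>R x \<in> S")
        case False
        then have "indicator E x *\<^sub>R F t x = 0" by (auto simp: F_def S(3) indicator_def)
        also have "0 \<le> t ^ n *\<^sub>R H (t *\<^sub>R x)" using H0 t by simp
        finally show ?thesis .
      next
        case True
        have "r *\<^sub>R x \<in> K" if "r \<in> {1..t}" for r
        proof (rule KI)
          have "dist (t *\<^sub>R x) (r *\<^sub>R x) = (t - r) * norm x"
            using that by (simp add: dist_norm flip: scaleR_diff_left)
          also have "\<dots> \<le> \<tau> * (t * norm x)"
          proof (intro mult_mono)
            show "norm x \<le> t * norm x" using t mult_right_mono[of 1 t "norm x"] by simp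
          qed (use that t \<tau> in \<open>auto simp: b_def\<close>)
          also have "t * norm x \<le> R" using True R(2)[of "t *\<^sub>R x"] t by simp
          finally show "dist (t *\<^sub>R x) (r *\<^sub>R x) \<le> \<eta>" using \<tau> by (simp add: mult_left_mono)
        qed (use True in auto)
        then have "lam (t *\<^sub>R x) \<le> lam x" using t \<open>K \<subseteq> \<Omega>\<close> by (intro mono) auto
        moreover have tO: "t *\<^sub>R x \<in> \<Omega>" using True S by auto
        \<comment> \<open>The only place where the monotonicity of \<open>lam\<close> enters: the
          denominator of s does not grow along the ray.\<close>
        ultimately have st: "t * s x \<le> s (t *\<^sub>R x)"
          using t lampos[OF tO] by (auto simp: s_def intro!: divide_left_mono mult_pos_pos)
        have x: "0 < s x" "0 < norm x" using EO True by auto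
        have "0 < t * s x" using x t by auto
        then have "g_fun k (s (t *\<^sub>R x)) \<le> g_fun k (t * s x)" "0 < g_fun k (s (t *\<^sub>R x))"
          using st s1[OF tO] by (auto intro: g_fun_antimono g_fun_pos)
        then have "g_fun k (t * s x) powr (- q) \<le> g_fun k (s (t *\<^sub>R x)) powr (- q)"
          using q by (intro powr_mono2') auto
        moreover have "\<epsilon> \<le> norm (t *\<^sub>R x)"
          using True t mult_right_mono[of 1 t "norm x"] by (auto simp: E_def)
        moreover have "norm x powr (- a) * t powr (n - a) = t ^ n * norm (t *\<^sub>R x) powr (- a)"
          using t x by (simp add: powr_mult powr_diff powr_minus powr_realpow divide_simps)
        ultimately show ?thesis
          using True t
          by (simp add: F_def H_def mult.assoc[symmetric] del: norm_scaleR)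
            (simp add: mult_left_mono mult_right_mono del: norm_scaleR)
      qed
    qed
    also have "\<dots> = (\<integral>x. H x \<partial>lborel)"
      using t integral_lborel_scaleR[OF Hint, of t] by (simp add: n_def)
    also have "\<dots> = (LINT x:E|lborel. F 1 x)"
      by (simp add: set_lebesgue_integral_def HF)
    finally show ?thesis .
  qed
  have "(LINT x:E|lborel. F' 1 x) \<le> 0"
    by (rule set_integral_derivative_nonpos[OF cE b1 contF' derivF contF le])
  also have "(LINT x:E|lborel. F' 1 x) = (LINT x:{x\<in>S. \<epsilon> \<le> norm x}|lborel. norm x powr (- a) *
      (q * g x powr (- q - 1) * \<bar>\<phi> x\<bar> powr p +
       g x powr (- q) * (p * (sgn (\<phi> x) * \<bar>\<phi> x\<bar> powr (p - 1)) * (x \<bullet> D\<phi> x))))"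
    unfolding set_lebesgue_integral_def
  proof (intro Bochner_Integration.integral_cong refl)
    fix x
    show "indicator E x *\<^sub>R F' 1 x = indicator {x\<in>S. \<epsilon> \<le> norm x} x *\<^sub>R (norm x powr (- a) *
      (q * g x powr (- q - 1) * \<bar>\<phi> x\<bar> powr p +
       g x powr (- q) * (p * (sgn (\<phi> x) * \<bar>\<phi> x\<bar> powr (p - 1)) * (x \<bullet> D\<phi> x))))"
    proof (cases "x \<in> S \<and> \<epsilon> \<le> norm x")
      case True
      then have xE: "x \<in> E" using \<open>S \<subseteq> K\<close> by (auto simp: E_def)
      have gp: "0 < g x" using gpos[OF _ xE, of 1] b1 by (simp add: g)
      have sp: "0 < s x" using EO[OF xE] by simp
      \<comment> \<open>By n - a = k q the factor q g^(-q - 1) can be taken out of both terms; what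
        remains is k g + s^k, which equals 1. This explains the value of
        \<open>weight_index\<close>.\<close>
      have "(n - a) * g x powr (- q) + q * g x powr (- q - 1) * (s x powr (k - 1) * s x)
          = q * g x powr (- q - 1) * (k * g x + s x powr k)"
        using gp sp k by (simp add: n_def powr_diff field_simps)
      also have "k * g x + s x powr k = 1" unfolding g by (rule g_fun_identity[OF sp])
      finally have "(n - a) * g x powr (- q) + q * g x powr (- q - 1) * (s x powr (k - 1) * s x)
          = q * g x powr (- q - 1)" by simp
      then show ?thesis using True xE by (simp add: F'_def g mult.assoc[symmetric])
    next
      \<comment> \<open>Off S the integrand vanishes together with \<phi>, because
        \<open>0 powr c = 0\<close>; inside the radius \<epsilon> both indicators vanish.\<close>
      case False
      then have "indicator E x *\<^sub>R F' 1 x = 0"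
        using S(3)[of x] by (auto simp: E_def F'_def indicator_def)
      with False show ?thesis by simp
    qed
  qed
  finally show ?thesis .
qed

text \<open>Here N, d and y stand for |x|, the norm of the gradient and their inner product.
  Multiply the divergence bound by c^(p - 1) and apply Young to c w |f| and v d. Then w^p |f|^p
  keeps the coefficient p \<gamma> c^(p - 1) - (p - 1) c^p, whose maximum over c > 0 is attained at
  c = \<gamma> and equals \<gamma>^p.\<close>

lemma hardy_Young:
  fixes N g f d y \<alpha> \<beta> p \<gamma> :: real
  assumes N: "0 < N" and g: "0 < g" and d: "0 \<le> d" and y: "\<bar>y\<bar> \<le> N * d"
    and p: "1 < p" and \<gamma>: "0 < \<gamma>" and q: "\<beta> * p - 1 = p * \<gamma>"
  shows "\<gamma> powr p * ((N powr (- \<alpha>) * g powr (- \<beta>)) powr p * \<bar>f\<bar> powr p)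
      - (N powr (1 - \<alpha>) * g powr (1 - \<beta>)) powr p * d powr p
    \<le> \<gamma> powr (p - 1) * (N powr (- (\<alpha> * p)) *
      ((\<beta> * p - 1) * g powr (- (\<beta> * p - 1) - 1) * \<bar>f\<bar> powr p +
       g powr (- (\<beta> * p - 1)) * (p * (sgn f * \<bar>f\<bar> powr (p - 1)) * y)))"
proof -
  define w where "w = N powr (- \<alpha>) * g powr (- \<beta>)"
  define v where "v = N powr (1 - \<alpha>) * g powr (1 - \<beta>)"
  define A where "A = \<gamma> * w * \<bar>f\<bar>"
  define Z where "Z = \<gamma> powr (p - 1) * N powr (- (\<alpha> * p)) * g powr (- (\<beta> * p - 1)) * \<bar>f\<bar> powr (p - 1)"
  have pos: "0 < w" "0 < v" using N g by (auto simp: w_def v_def)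
  have wp: "w powr p = N powr (- (\<alpha> * p)) * g powr (- (\<beta> * p - 1) - 1)"
    using N g by (simp add: w_def powr_mult powr_powr)
  have Ap: "A powr p = \<gamma> powr p * (w powr p * \<bar>f\<bar> powr p)"
    using pos \<gamma> by (simp add: A_def powr_mult)
  \<comment> \<open>The weights match exactly: w^(p - 1) v equals N times the radial coefficient
    N^(-\<alpha>p) g^(1 - \<beta>p) of the field, so Young's inequality can be applied to the cross
    term without loss in the weights.\<close>
  have Z: "Z * (N * d) = A powr (p - 1) * (v * d)"
  proof -
    have "w powr (p - 1) * v = (N powr (- (\<alpha> * (p - 1))) * N powr (1 - \<alpha>)) *
        (g powr (- (\<beta> * (p - 1))) * g powr (1 - \<beta>))"
      using N g by (simp add: w_def v_def powr_mult powr_powr)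
    also have "\<dots> = N powr (- (\<alpha> * p) + 1) * g powr (- (\<beta> * p - 1))"
      by (simp add: powr_add[symmetric] algebra_simps)
    also have "\<dots> = N powr (- (\<alpha> * p)) * N * g powr (- (\<beta> * p - 1))"
      using N by (simp only: powr_add powr_one order.strict_implies_order[OF N])
    finally have "w powr (p - 1) * v = N powr (- (\<alpha> * p)) * N * g powr (- (\<beta> * p - 1))" .
    moreover have "A powr (p - 1) = \<gamma> powr (p - 1) * w powr (p - 1) * \<bar>f\<bar> powr (p - 1)"
      using pos \<gamma> by (simp add: A_def powr_mult)
    ultimately show ?thesis by (simp add: Z_def mult_ac)
  qed
  have "p * (A powr (p - 1) * (v * d)) \<le> (p - 1) * A powr p + (v * d) powr p"
    using p pos \<gamma> d by (intro Young_powr) (auto simp: A_def)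
  moreover have "(v * d) powr p = v powr p * d powr p" using pos d by (simp add: powr_mult)
  moreover have "- (Z * (N * d)) \<le> Z * sgn f * y"
  proof -
    have "\<bar>Z * sgn f * y\<bar> = Z * \<bar>sgn f\<bar> * \<bar>y\<bar>" by (simp add: Z_def abs_mult)
    also have "\<dots> \<le> Z * 1 * (N * d)"
      using y N d by (intro mult_mono) (auto simp: Z_def sgn_if)
    finally show ?thesis by simp
  qed
  then have "- (p * (A powr (p - 1) * (v * d))) \<le> p * (Z * sgn f * y)"
    using mult_left_mono[of "- (Z * (N * d))" "Z * sgn f * y" p] p Z by simp
  ultimately have "p * A powr p + p * (Z * sgn f * y) \<ge> A powr p - v powr p * d powr p"
    by (simp add: algebra_simps)
  moreover have "p * A powr p = \<gamma> powr (p - 1) * (\<beta> * p - 1) * (w powr p * \<bar>f\<bar> powr p)"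
    using \<gamma> by (simp add: Ap q powr_diff)
  ultimately show ?thesis
    unfolding w_def[symmetric] v_def[symmetric] Ap wp Z_def by (simp add: algebra_simps)
qed

text \<open>The energies are stated for the completed measure, whereas the dilation estimate lives
  on \<open>lborel\<close>.\<close>

lemma weighted_energy_lborel:
  fixes \<Omega> :: "'a::euclidean_space set"
  assumes "\<Omega> \<in> sets borel"
  shows "weighted_energy p \<rho> \<Omega> F =
    (\<integral>\<^sup>+x. ennreal (\<rho> x powr p * norm (F x) powr p) * indicator \<Omega> x \<partial>lborel)"
  unfolding weighted_energy_def using assms
  by (subst nn_integral_restrict_space) (auto simp: nn_integral_completion)

lemma hardy_test_function:
  fixes lam \<phi> :: "real^'n \<Rightarrow> real"
  assumes \<Omega>: "open \<Omega>" and lam: "continuous_on \<Omega> lam"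
    and less: "\<And>x. x \<in> \<Omega> \<Longrightarrow> norm x < lam x"
    and mono: "\<And>x t. 1 \<le> t \<Longrightarrow> (\<And>s. s \<in> {1..t} \<Longrightarrow> s *\<^sub>R x \<in> \<Omega>) \<Longrightarrow> lam (t *\<^sub>R x) \<le> lam x"
    and \<phi>: "\<phi> \<in> test_functions \<Omega>"
    and p: "1 < p" and q: "1 < \<beta> * p" and \<gamma>: "\<gamma> = (\<beta> * p - 1) / p"
  shows "ennreal (\<gamma> powr p) * weighted_energy p (weight_w \<alpha> \<beta> p lam) \<Omega> \<phi>
    \<le> weighted_energy p (weight_v \<alpha> \<beta> p lam) \<Omega> (grad \<phi>)"
proof -
  define k where "k = weight_index CARD('n) \<alpha> \<beta> p"
  define S where "S = closure {x. \<phi> x \<noteq> 0}"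
  have S: "compact S" "S \<subseteq> \<Omega>" using \<phi> by (auto simp: test_functions_def S_def)
  have S0: "\<phi> x = 0" if "x \<notin> S" for x
    using that closure_subset[of "{x. \<phi> x \<noteq> 0}"] by (auto simp: S_def)
  have C1: "Ck (Suc 0) \<phi>" using \<phi> unfolding test_functions_def by blast
  have D: "GDERIV \<phi> x :> grad \<phi> x" for x by (rule Ck_imp_GDERIV[OF C1])
  have contD: "continuous_on A (grad \<phi>)" for A by (rule Ck_imp_continuous_on_grad[OF C1])
  have cont\<phi>: "continuous_on A \<phi>" for A
    using D by (intro continuous_at_imp_continuous_on)
      (auto simp: gderiv_def intro: has_derivative_continuous)
  define g where "g x = g_fun k (norm x / lam x)" for x
  have gpos: "0 < g x" if "x \<in> \<Omega>" "x \<noteq> 0" for x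
  proof -
    have "0 < lam x" using less[OF that(1)] norm_ge_zero[of x] by linarith
    then show ?thesis using less[OF that(1)] that(2) unfolding g_def by (intro g_fun_pos) auto
  qed
  define W where "W x = weight_w \<alpha> \<beta> p lam x powr p * \<bar>\<phi> x\<bar> powr p" for x
  define V where "V x = weight_v \<alpha> \<beta> p lam x powr p * norm (grad \<phi> x) powr p" for x
  have WV0: "0 \<le> W x" "0 \<le> V x" for x by (simp_all add: W_def V_def)
  have W: "W x = (norm x powr (- \<alpha>) * g x powr (- \<beta>)) powr p * \<bar>\<phi> x\<bar> powr p"
    and V: "V x = (norm x powr (1 - \<alpha>) * g x powr (1 - \<beta>)) powr p * norm (grad \<phi> x) powr p"
    if "x \<in> \<Omega>" "x \<noteq> 0" for x
    using gpos[OF that] by (simp_all add: W_def V_def weight_w_def weight_v_def g_def k_def)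
  define T where "T x = norm x powr (- (\<alpha> * p)) *
      ((\<beta> * p - 1) * g x powr (- (\<beta> * p - 1) - 1) * \<bar>\<phi> x\<bar> powr p +
       g x powr (- (\<beta> * p - 1)) * (p * (sgn (\<phi> x) * \<bar>\<phi> x\<bar> powr (p - 1)) * (x \<bullet> grad \<phi> x)))" for x
  have \<gamma>0: "0 < \<gamma>" using p q by (simp add: \<gamma>)
  \<comment> \<open>Away from the origin all terms are continuous on a compact set, hence
    integrable, and the integral of the pointwise inequality may be split. The origin is recovered
    as m tends to infinity.\<close>
  define S' where "S' m = {x\<in>S. 1 / real (Suc m) \<le> norm x}" for m
  have S': "x \<in> \<Omega>" "x \<noteq> 0" if "x \<in> S' m" for x m
    using that S(2) by (auto simp: S'_def divide_le_0_iff)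
  have cS': "compact (S' m)" for m
  proof -
    have "closed {x::real^'n. 1 / real (Suc m) \<le> norm x}"
      by (intro closed_Collect_le continuous_intros)
    moreover have "S' m = S \<inter> {x. 1 / real (Suc m) \<le> norm x}" by (auto simp: S'_def)
    ultimately show ?thesis using S(1) by (auto intro: compact_Int_closed)
  qed
  have le: "(\<integral>\<^sup>+x. ennreal (\<gamma> powr p * W x) * indicator (S' m) x \<partial>lborel)
      \<le> weighted_energy p (weight_v \<alpha> \<beta> p lam) \<Omega> (grad \<phi>)"
    and int_W: "set_integrable lborel (S' m) W" for m
  proof -
    have n0: "norm x \<noteq> 0" "g x \<noteq> 0" "lam x \<noteq> 0" "0 < norm x / lam x" if "x \<in> S' m" for x
    proof -
      have "0 < lam x" using less[OF S'(1)[OF that]] norm_ge_zero[of x] by linarith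
      then show "norm x \<noteq> 0" "g x \<noteq> 0" "lam x \<noteq> 0" "0 < norm x / lam x"
        using S'[OF that] gpos[OF S'[OF that]] by auto
    qed
    have contg: "continuous_on (S' m) g"
      unfolding g_def
    proof (rule continuous_on_compose2[OF continuous_on_g_fun])
      show "continuous_on (S' m) (\<lambda>x. norm x / lam x)"
        using S'(1) n0 by (intro continuous_intros continuous_on_subset[OF lam]) auto
    qed (use n0 in auto)
    have c1: "continuous_on (S' m) (\<lambda>x. norm x powr c)" for c
      using n0 by (intro continuous_on_powr continuous_intros) auto
    have c2: "continuous_on (S' m) (\<lambda>x. g x powr c)" for c
      using n0 by (intro continuous_on_powr contg continuous_intros) auto
    have c3: "continuous_on (S' m) (\<lambda>x. \<bar>\<phi> x\<bar> powr p)"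
      using p by (intro continuous_on_powr' continuous_on_rabs cont\<phi> continuous_on_const) auto
    have c4: "continuous_on (S' m) (\<lambda>x. sgn (\<phi> x) * \<bar>\<phi> x\<bar> powr (p - 1))"
      using p by (intro continuous_on_compose2[OF continuous_on_sgn_abs_powr[of "p - 1"] cont\<phi>]) auto
    have c5: "continuous_on (S' m) (\<lambda>x. norm (grad \<phi> x) powr p)"
      using p by (intro continuous_on_powr' continuous_on_norm contD continuous_on_const) auto
    have contT: "continuous_on (S' m) T"
      unfolding T_def
      by (intro continuous_on_mult continuous_on_add continuous_on_const continuous_on_inner
          continuous_on_id contD c1 c2 c3 c4)
    have contW: "continuous_on (S' m) W"
    proof (subst continuous_on_cong[OF refl W[OF S']])
      show "continuous_on (S' m) (\<lambda>x. (norm x powr (- \<alpha>) * g x powr (- \<beta>)) powr p * \<bar>\<phi> x\<bar> powr p)"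
        using n0 by (intro continuous_on_mult continuous_on_powr continuous_on_const c1 c2 c3) auto
    qed
    have contV: "continuous_on (S' m) V"
    proof (subst continuous_on_cong[OF refl V[OF S']])
      show "continuous_on (S' m)
          (\<lambda>x. (norm x powr (1 - \<alpha>) * g x powr (1 - \<beta>)) powr p * norm (grad \<phi> x) powr p)"
        using n0 by (intro continuous_on_mult continuous_on_powr continuous_on_const c1 c2 c5) auto
    qed
    have int: "set_integrable lborel (S' m) T" "set_integrable lborel (S' m) W"
      "set_integrable lborel (S' m) V"
      unfolding set_integrable_def by (intro borel_integrable_compact cS' contT contW contV)+
    have T0: "(LINT x:S' m|lborel. T x) \<le> 0"
      unfolding T_def g_def S'_def
    proof (rule hardy_dilation[OF \<Omega> lam less mono D contD S S0 p])
      show "real DIM(real^'n) - \<alpha> * p = k * (\<beta> * p - 1)"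
        using q by (simp add: k_def weight_index_def)
    qed (use q in auto)
    have "\<gamma> powr p * W x \<le> \<gamma> powr (p - 1) * T x + V x" if "x \<in> S' m" for x
    proof -
      have "\<bar>x \<bullet> grad \<phi> x\<bar> \<le> norm x * norm (grad \<phi> x)" by (rule Cauchy_Schwarz_ineq2)
      from hardy_Young[OF _ gpos[OF S'[OF that]] norm_ge_zero this p \<gamma>0, of \<beta> \<alpha> "\<phi> x"]
      show ?thesis
        using p S'[OF that] by (simp add: W V T_def \<gamma>)
    qed
    then have "(LINT x:S' m|lborel. \<gamma> powr p * W x)
        \<le> (LINT x:S' m|lborel. \<gamma> powr (p - 1) * T x + V x)"
      using int by (intro set_integral_mono set_integral_add(1) set_integrable_mult_right) auto
    also have "\<dots> = \<gamma> powr (p - 1) * (LINT x:S' m|lborel. T x) + (LINT x:S' m|lborel. V x)"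
      using int by (subst set_integral_add(2)) (auto intro: set_integrable_mult_right)
    also have "\<dots> \<le> (LINT x:S' m|lborel. V x)"
      using T0 by (simp add: mult_nonneg_nonpos)
    finally have *: "(LINT x:S' m|lborel. \<gamma> powr p * W x) \<le> (LINT x:S' m|lborel. V x)" .
    have nn: "(\<integral>\<^sup>+x. ennreal (h x) * indicator (S' m) x \<partial>lborel) = ennreal (LINT x:S' m|lborel. h x)"
      if "set_integrable lborel (S' m) h" "\<And>x. 0 \<le> h x" for h
    proof -
      have "(\<integral>\<^sup>+x. ennreal (h x) * indicator (S' m) x \<partial>lborel)
          = (\<integral>\<^sup>+x. ennreal (indicator (S' m) x *\<^sub>R h x) \<partial>lborel)"
        by (intro nn_integral_cong) (auto simp: indicator_def)
      also have "\<dots> = ennreal (LINT x:S' m|lborel. h x)"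
        using that unfolding set_lebesgue_integral_def set_integrable_def
        by (intro nn_integral_eq_integral) auto
      finally show ?thesis .
    qed
    have "(\<integral>\<^sup>+x. ennreal (\<gamma> powr p * W x) * indicator (S' m) x \<partial>lborel)
        = ennreal (LINT x:S' m|lborel. \<gamma> powr p * W x)"
      using int(2) by (intro nn set_integrable_mult_right mult_nonneg_nonneg WV0) auto
    also have "\<dots> \<le> ennreal (LINT x:S' m|lborel. V x)" using * by (rule ennreal_leI)
    also have "\<dots> = (\<integral>\<^sup>+x. ennreal (V x) * indicator (S' m) x \<partial>lborel)"
      using int by (intro nn[symmetric] WV0)
    also have "\<dots> \<le> (\<integral>\<^sup>+x. ennreal (V x) * indicator \<Omega> x \<partial>lborel)"
      using S'(1) by (intro nn_integral_mono mult_left_mono) (auto simp: indicator_def)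
    also have "\<dots> = weighted_energy p (weight_v \<alpha> \<beta> p lam) \<Omega> (grad \<phi>)"
      using \<Omega> by (simp add: weighted_energy_lborel V_def)
    finally show "(\<integral>\<^sup>+x. ennreal (\<gamma> powr p * W x) * indicator (S' m) x \<partial>lborel)
      \<le> weighted_energy p (weight_v \<alpha> \<beta> p lam) \<Omega> (grad \<phi>)" .
    show "set_integrable lborel (S' m) W" by (rule int(2))
  qed
  have meas: "(\<lambda>x. ennreal (c * W x) * indicator (S' m) x) \<in> borel_measurable lborel" for c m
  proof -
    have "(\<lambda>x. ennreal (c * (indicator (S' m) x *\<^sub>R W x))) \<in> borel_measurable lborel"
      using int_W[of m] unfolding set_integrable_def by measurable
    also have "(\<lambda>x. ennreal (c * (indicator (S' m) x *\<^sub>R W x)))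
        = (\<lambda>x. ennreal (c * W x) * indicator (S' m) x)"
      by (auto simp: indicator_def)
    finally show ?thesis .
  qed
  \<comment> \<open>If W x is nonzero then x is in S and x is not 0, as the conventional value of
    the weight at the origin is 0. Such an x belongs to S' m for all large m.\<close>
  have lim: "(\<lambda>m. ennreal (c * W x) * indicator (S' m) x) \<longlonglongrightarrow> ennreal (c * W x) * indicator \<Omega> x" for c x
  proof (cases "W x = 0")
    case False
    then have "x \<noteq> 0" by (auto simp: W_def weight_w_def)
    have "x \<in> S" using False S0[of x] by (auto simp: W_def)
    have "\<forall>\<^sub>F m in sequentially. inverse (real (Suc m)) < norm x"
      using \<open>x \<noteq> 0\<close> by (intro order_tendstoD(2)[OF LIMSEQ_inverse_real_of_nat]) auto
    then have "\<forall>\<^sub>F m in sequentially. ennreal (c * W x) * indicator (S' m) x = ennreal (c * W x) * indicator \<Omega> x"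
      by eventually_elim (use \<open>x \<in> S\<close> S(2) in \<open>auto simp: S'_def indicator_def inverse_eq_divide\<close>)
    then show ?thesis by (rule tendsto_eventually)
  qed simp
  \<comment> \<open>Measurability on \<Omega> is inherited from the truncations; the factor 1 is the
    instance of the constant c in \<open>lim\<close> and \<open>meas\<close>.\<close>
  have meas\<Omega>: "(\<lambda>x. ennreal (1 * W x) * indicator \<Omega> x) \<in> borel_measurable lborel"
    by (rule borel_measurable_LIMSEQ_order[OF lim meas])
  have "ennreal (\<gamma> powr p) * weighted_energy p (weight_w \<alpha> \<beta> p lam) \<Omega> \<phi>
      = ennreal (\<gamma> powr p) * (\<integral>\<^sup>+x. ennreal (1 * W x) * indicator \<Omega> x \<partial>lborel)"
    using \<Omega> by (simp add: weighted_energy_lborel W_def)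
  also have "\<dots> = (\<integral>\<^sup>+x. ennreal (\<gamma> powr p) * (ennreal (1 * W x) * indicator \<Omega> x) \<partial>lborel)"
    by (rule nn_integral_cmult[OF meas\<Omega>, symmetric])
  also have "\<dots> = (\<integral>\<^sup>+x. ennreal (\<gamma> powr p * W x) * indicator \<Omega> x \<partial>lborel)"
    by (intro nn_integral_cong) (simp add: W_def ennreal_mult mult.assoc)
  also have "\<dots> = (\<integral>\<^sup>+x. liminf (\<lambda>m. ennreal (\<gamma> powr p * W x) * indicator (S' m) x) \<partial>lborel)"
    by (intro nn_integral_cong lim_imp_Liminf[symmetric] lim) simp
  also have "\<dots> \<le> liminf (\<lambda>m. \<integral>\<^sup>+x. ennreal (\<gamma> powr p * W x) * indicator (S' m) x \<partial>lborel)"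
    by (rule nn_integral_liminf[OF meas])
  also have "\<dots> \<le> weighted_energy p (weight_v \<alpha> \<beta> p lam) \<Omega> (grad \<phi>)"
    using le by (intro Liminf_le) auto
  finally show ?thesis .
qed

section \<open>Passage from test functions to the completion\<close>

theorem theorem3p1:
  fixes \<Omega> \<Omega>s :: "(real^'n) set" and lam :: "real^'n \<Rightarrow> real"
    and \<alpha> \<beta> p \<gamma> :: real
  assumes "CARD('n) \<ge> 2"
    and "open \<Omega>" "connected \<Omega>" "bounded \<Omega>" "0 \<in> \<Omega>"
    and "open \<Omega>s" "connected \<Omega>s" "\<Omega> \<subseteq> \<Omega>s"
    and "loc_lipschitz_on \<Omega>s lam"
    and "\<forall>x\<in>\<Omega>s. 0 < lam x"
    and "AE x in lebesgue_on \<Omega>s. norm x < lam x \<and> (\<exists>D. GDERIV lam x :> D \<and> x \<bullet> D \<le> 0)"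
    and "p > 1" "\<beta> * p > 1" "\<alpha> * p \<le> real CARD('n) + \<beta> * p - 1"
    and "\<gamma> = (\<beta> * p - 1) / p"
  shows "\<forall>u \<in> sobolev0 p (weight_v \<alpha> \<beta> p lam) \<Omega>.
    \<forall>G. sobolev0_gradient p (weight_v \<alpha> \<beta> p lam) \<Omega> u G \<longrightarrow>
      (\<integral>\<^sup>+x. ennreal (weight_v \<alpha> \<beta> p lam x powr p * norm (G x) powr p) \<partial>lebesgue_on \<Omega>)
      \<ge> ennreal (\<gamma> powr p) *
        (\<integral>\<^sup>+x. ennreal (weight_w \<alpha> \<beta> p lam x powr p * \<bar>u x\<bar> powr p) \<partial>lebesgue_on \<Omega>)"
proof (intro ballI allI impI)
  fix u G
  let ?v = "weight_v \<alpha> \<beta> p lam" and ?w = "weight_w \<alpha> \<beta> p lam"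
  assume "sobolev0_gradient p ?v \<Omega> u G"
  then obtain \<phi> where G: "G \<in> borel_measurable (lebesgue_on \<Omega>)"
    and \<phi>: "\<And>m. \<phi> m \<in> test_functions \<Omega>"
    and lim: "(\<lambda>m. weighted_energy p ?v \<Omega> (\<lambda>x. grad (\<phi> m) x - G x)) \<longlonglongrightarrow> 0"
    and ae: "AE x in lebesgue_on \<Omega>. (\<lambda>m. \<phi> m x) \<longlonglongrightarrow> u x"
    by (auto simp: sobolev0_gradient_def)
  note \<Omega> = \<open>open \<Omega>\<close> and \<Omega>s = \<open>open \<Omega>s\<close> \<open>\<Omega> \<subseteq> \<Omega>s\<close> and lip = \<open>loc_lipschitz_on \<Omega>s lam\<close>
    and p = \<open>p > 1\<close> and q = \<open>\<beta> * p > 1\<close> and \<gamma> = \<open>\<gamma> = (\<beta> * p - 1) / p\<close>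
  have cont: "continuous_on \<Omega> lam"
    using loc_lipschitz_on_imp_continuous_on[OF lip] \<Omega>s(2) by (rule continuous_on_subset)
  \<comment> \<open>With \<open>less\<close> and \<open>mono\<close> both almost everywhere
    hypotheses on \<open>lam\<close> have become pointwise; beyond them its gradient does not
    occur.\<close>
  have less: "norm x < lam x" if "x \<in> \<Omega>" for x
    using assms that by (intro norm_less_of_radial[OF \<Omega>s(1) lip]) auto
  have mono: "lam (t *\<^sub>R x) \<le> lam x" if "1 \<le> t" "\<And>s. s \<in> {1..t} \<Longrightarrow> s *\<^sub>R x \<in> \<Omega>" for x t
  proof (rule nonincreasing_along_rays[OF \<Omega>s(1) lip _ that(1)])
    show "AE x in lebesgue_on \<Omega>s. \<exists>D. GDERIV lam x :> D \<and> x \<bullet> D \<le> 0"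
      using assms(11) by eventually_elim auto
    show "s *\<^sub>R x \<in> \<Omega>s" if "s \<in> {1..t}" for s
      using that \<open>\<And>s. s \<in> {1..t} \<Longrightarrow> s *\<^sub>R x \<in> \<Omega>\<close> \<Omega>s(2) by blast
  qed
  have test: "ennreal (\<gamma> powr p) * weighted_energy p ?w \<Omega> (\<phi> m) \<le> weighted_energy p ?v \<Omega> (grad (\<phi> m))" for m
    by (rule hardy_test_function[OF \<Omega> cont less mono \<phi> p q \<gamma>])
  have \<gamma>0: "0 < \<gamma>" using p q by (simp add: \<gamma>)
  \<comment> \<open>The inverse of \<gamma>^p lets the energies of the \<phi> m stand alone under
    the limit inferior; the factor is restored afterwards.\<close>
  define c where "c = 1 / \<gamma> powr p"
  have c: "ennreal c * ennreal (\<gamma> powr p) = 1"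
    using \<gamma>0 by (simp add: c_def ennreal_mult[symmetric])
  have \<Omega>m: "\<Omega> \<in> sets lebesgue" using \<Omega> by auto
  have [measurable]: "lam \<in> borel_measurable (lebesgue_on \<Omega>)"
    by (intro continuous_imp_measurable_on_sets_lebesgue cont \<Omega>m)
  have [measurable]: "(\<lambda>x. norm x) \<in> borel_measurable (lebesgue_on \<Omega>)"
    by (intro continuous_imp_measurable_on_sets_lebesgue continuous_intros \<Omega>m)
  have [measurable]: "g_fun k \<in> borel_measurable borel" for k
    unfolding g_fun_def[abs_def] by measurable
  have [measurable]: "?v \<in> borel_measurable (lebesgue_on \<Omega>)" "?w \<in> borel_measurable (lebesgue_on \<Omega>)"
    unfolding weight_v_def[abs_def] weight_w_def[abs_def] by measurable
  have C1: "Ck (Suc 0) (\<phi> m)" for m using \<phi>[of m] unfolding test_functions_def by blast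
  have [measurable]: "grad (\<phi> m) \<in> borel_measurable (lebesgue_on \<Omega>)" for m
    by (intro continuous_imp_measurable_on_sets_lebesgue Ck_imp_continuous_on_grad C1 \<Omega>m)
  have [measurable]: "\<phi> m \<in> borel_measurable (lebesgue_on \<Omega>)" for m
    using Ck_imp_GDERIV[OF C1]
    by (intro continuous_imp_measurable_on_sets_lebesgue continuous_at_imp_continuous_on \<Omega>m)
      (auto simp: gderiv_def intro: has_derivative_continuous)
  note [measurable] = G
  \<comment> \<open>The gradient of \<phi> m is G plus an error whose energy tends to 0. The
    inequality holds in [0,\<infinity>], so finiteness of the energy of G need not be settled
    here.\<close>
  have conv: "weighted_energy p ?v \<Omega> (grad (\<phi> m)) \<le> ennreal ((1 - \<theta>) powr (1 - p)) * weighted_energy p ?v \<Omega> G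
      + ennreal (\<theta> powr (1 - p)) * weighted_energy p ?v \<Omega> (\<lambda>x. grad (\<phi> m) x - G x)"
    if \<theta>: "0 < \<theta>" "\<theta> < 1" for m \<theta>
  proof -
    let ?E = "\<lambda>F x. ennreal (?v x powr p * norm (F x :: real^'n) powr p)"
    have "?E (grad (\<phi> m)) x \<le> ennreal ((1 - \<theta>) powr (1 - p)) * ?E G x
        + ennreal (\<theta> powr (1 - p)) * ?E (\<lambda>x. grad (\<phi> m) x - G x) x" for x
    proof -
      have "norm (grad (\<phi> m) x) powr p \<le> (norm (G x) + norm (grad (\<phi> m) x - G x)) powr p"
        using p norm_triangle_ineq[of "G x" "grad (\<phi> m) x - G x"] by (intro powr_mono2) auto
      also have "\<dots> \<le> (1 - \<theta>) powr (1 - p) * norm (G x) powr p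
          + \<theta> powr (1 - p) * norm (grad (\<phi> m) x - G x) powr p"
        using p \<theta> by (intro powr_add_le_weighted) auto
      finally have "?v x powr p * norm (grad (\<phi> m) x) powr p \<le>
          (1 - \<theta>) powr (1 - p) * (?v x powr p * norm (G x) powr p)
          + \<theta> powr (1 - p) * (?v x powr p * norm (grad (\<phi> m) x - G x) powr p)"
        using mult_left_mono[of _ _ "?v x powr p"] by (fastforce simp: algebra_simps)
      then show ?thesis
        by (simp add: ennreal_mult[symmetric] ennreal_plus[symmetric] ennreal_leI del: ennreal_plus)
    qed
    then have "weighted_energy p ?v \<Omega> (grad (\<phi> m)) \<le> (\<integral>\<^sup>+x. ennreal ((1 - \<theta>) powr (1 - p)) * ?E G x
        + ennreal (\<theta> powr (1 - p)) * ?E (\<lambda>x. grad (\<phi> m) x - G x) x \<partial>lebesgue_on \<Omega>)"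
      unfolding weighted_energy_def by (intro nn_integral_mono)
    also have "\<dots> = ennreal ((1 - \<theta>) powr (1 - p)) * weighted_energy p ?v \<Omega> G
      + ennreal (\<theta> powr (1 - p)) * weighted_energy p ?v \<Omega> (\<lambda>x. grad (\<phi> m) x - G x)"
      unfolding weighted_energy_def by (subst nn_integral_add) (simp_all add: nn_integral_cmult)
    finally show ?thesis .
  qed
  \<comment> \<open>The order of limits matters: m tends to infinity with \<theta> fixed, which
    removes the error term however large \<theta>^(1 - p) is; only then \<theta> tends to 0.\<close>
  have limit: "ennreal (\<gamma> powr p) * weighted_energy p ?w \<Omega> u
      \<le> ennreal ((1 - \<theta>) powr (1 - p)) * weighted_energy p ?v \<Omega> G" if \<theta>: "0 < \<theta>" "\<theta> < 1" for \<theta>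
  proof -
    let ?X = "\<lambda>m. ennreal ((1 - \<theta>) powr (1 - p)) * weighted_energy p ?v \<Omega> G
      + ennreal (\<theta> powr (1 - p)) * weighted_energy p ?v \<Omega> (\<lambda>x. grad (\<phi> m) x - G x)"
    have "AE x in lebesgue_on \<Omega>. ennreal (?w x powr p * norm (u x) powr p)
        = liminf (\<lambda>m. ennreal (?w x powr p * norm (\<phi> m x) powr p))"
      using ae
    proof eventually_elim
      case (elim x)
      have "(\<lambda>m. \<bar>\<phi> m x\<bar> powr p) \<longlonglongrightarrow> \<bar>u x\<bar> powr p"
        by (rule isCont_tendsto_compose[OF DERIV_isCont[OF DERIV_abs_powr[OF p]] elim])
      then have "(\<lambda>m. ennreal (?w x powr p * norm (\<phi> m x) powr p)) \<longlonglongrightarrow> ennreal (?w x powr p * norm (u x) powr p)"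
        by (intro tendsto_ennrealI tendsto_mult tendsto_const) simp
      then show ?case by (intro lim_imp_Liminf[symmetric]) simp
    qed
    then have "weighted_energy p ?w \<Omega> u
        = (\<integral>\<^sup>+x. liminf (\<lambda>m. ennreal (?w x powr p * norm (\<phi> m x) powr p)) \<partial>lebesgue_on \<Omega>)"
      unfolding weighted_energy_def by (rule nn_integral_cong_AE)
    also have "\<dots> \<le> liminf (\<lambda>m. weighted_energy p ?w \<Omega> (\<phi> m))"
      unfolding weighted_energy_def by (rule nn_integral_liminf) measurable
    also have "\<dots> \<le> liminf (\<lambda>m. ennreal c * ?X m)"
    proof (intro Liminf_mono always_eventually allI)
      fix m
      have "weighted_energy p ?w \<Omega> (\<phi> m)
          = ennreal c * (ennreal (\<gamma> powr p) * weighted_energy p ?w \<Omega> (\<phi> m))"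
        by (simp add: c mult.assoc[symmetric])
      also have "\<dots> \<le> ennreal c * ?X m"
        using order_trans[OF test conv[OF \<theta>]] by (rule mult_left_mono) simp
      finally show "weighted_energy p ?w \<Omega> (\<phi> m) \<le> ennreal c * ?X m" .
    qed
    also have "(\<lambda>m. ennreal c * ?X m) \<longlonglongrightarrow> ennreal c * (ennreal ((1 - \<theta>) powr (1 - p)) * weighted_energy p ?v \<Omega> G
        + ennreal (\<theta> powr (1 - p)) * 0)"
      by (intro ennreal_tendsto_cmult tendsto_add tendsto_const lim) auto
    then have "liminf (\<lambda>m. ennreal c * ?X m)
        = ennreal c * (ennreal ((1 - \<theta>) powr (1 - p)) * weighted_energy p ?v \<Omega> G)"
      by (intro lim_imp_Liminf) auto
    finally have "ennreal (\<gamma> powr p) * weighted_energy p ?w \<Omega> u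
        \<le> ennreal (\<gamma> powr p) * (ennreal c * (ennreal ((1 - \<theta>) powr (1 - p)) * weighted_energy p ?v \<Omega> G))"
      by (rule mult_left_mono) simp
    also have "\<dots> = (ennreal c * ennreal (\<gamma> powr p)) * (ennreal ((1 - \<theta>) powr (1 - p)) * weighted_energy p ?v \<Omega> G)"
      by (simp only: mult_ac)
    finally show ?thesis by (simp add: c)
  qed
  have "ennreal (\<gamma> powr p) * weighted_energy p ?w \<Omega> u \<le> weighted_energy p ?v \<Omega> G"
  proof (cases "weighted_energy p ?v \<Omega> G")
    case (real e)
    \<comment> \<open>Two successors keep \<theta> strictly below 1 already at m = 0.\<close>
    define \<theta> where "\<theta> m = inverse (real (Suc (Suc m)))" for m
    have \<theta>: "0 < \<theta> m" "\<theta> m < 1" for m by (auto simp: \<theta>_def inverse_less_1_iff)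
    have "\<theta> \<longlonglongrightarrow> 0" unfolding \<theta>_def by (rule LIMSEQ_Suc[OF LIMSEQ_inverse_real_of_nat])
    then have lim: "(\<lambda>m. ennreal ((1 - \<theta> m) powr (1 - p) * e)) \<longlonglongrightarrow> ennreal ((1 - 0) powr (1 - p) * e)"
      by (intro tendsto_ennrealI tendsto_intros) auto
    have "ennreal (\<gamma> powr p) * weighted_energy p ?w \<Omega> u \<le> ennreal ((1 - \<theta> m) powr (1 - p) * e)" for m
      using limit[OF \<theta>, of m] real by (simp add: ennreal_mult)
    then have "ennreal (\<gamma> powr p) * weighted_energy p ?w \<Omega> u \<le> ennreal ((1 - 0) powr (1 - p) * e)"
      by (intro LIMSEQ_le_const[OF lim]) auto
    then show ?thesis using real by simp
  qed simp
  then show "ennreal (\<gamma> powr p) * (\<integral>\<^sup>+x. ennreal (?w x powr p * \<bar>u x\<bar> powr p) \<partial>lebesgue_on \<Omega>)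
      \<le> (\<integral>\<^sup>+x. ennreal (?v x powr p * norm (G x) powr p) \<partial>lebesgue_on \<Omega>)"
    by (simp add: weighted_energy_def)
qed

end
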